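(* Let $N,M,\Lambda\ge 1$ and consider a network with layers $l=0,1,\dots,\Lambda$. For each $l\in\{1,\dots,\Lambda\}$ let $I^{(l)}_1,\dots,I^{(l)}_{N+1}$ and $R^{(l)}_1,\dots,R^{(l)}_{N+1}$ be positive integers with $I^{(l)}_1\cdots I^{(l)}_N=I^{(l-1)}_{N+1}$ for $l\ge2$, and let $\mathcal G^{(l)}\in\mathbb R^{R^{(l)}_1\times\cdots\times R^{(l)}_{N+1}}$, $\mathbf U^{(n)}_{(l)}\in\mathbb R^{I^{(l)}_n\times R^{(l)}_n}$ ($n=1,\dots,N+1$), $\mathbf b^{(l)}\in\mathbb R^{I^{(l)}_{N+1}}$, and $$\mathcal W^{(l)}=\mathcal G^{(l)}\times_1\mathbf U^{(1)}_{(l)}\times_2\cdots\times_{N+1}\mathbf U^{(N+1)}_{(l)}.$$ Let $\mathbf Z^{(0)}\in\mathbb R^{I^{(1)}_1\cdots I^{(1)}_N\times M}$ be the data matrix whose columns are the vectorizations of $M$ input tensors, let $\sigma:\mathbb R\to\mathbb R$ be a differentiable activation function applied entrywise, and for $l=1,\dots,\Lambda$ set $$\mathbf F^{(l)}=\mathcal W^{(l)}_{(N+1)}\mathbf Z^{(l-1)}+\mathbf B^{(l)},\qquad \mathbf B^{(l)}=\mathbf b^{(l)}\mathbf 1_M^T,\qquad \mathbf Z^{(l)}=\sigma(\mathbf F^{(l)}).$$ Let $L$ be a scalar loss that is a differentiable function of the network output $\mathbf Z^{(\Lambda)}$. Define $\mathbf D^{(l)}\in\mathbb R^{I^{(l)}_{N+1}\times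 M}$ by $$\mathbf D^{(\Lambda)}=\frac{\partial L}{\partial\mathbf F^{(\Lambda)}},\qquad \mathbf D^{(l)}=\big(\mathcal W^{(l+1)T}_{(N+1)}\mathbf D^{(l+1)}\big)\odot\sigma'(\mathbf F^{(l)})\quad(l=\Lambda-1,\dots,1).$$ Then for every $l\in\{1,\dots,\Lambda\}$ the gradients of $L$ with respect to the parameters of layer $l$ (all other parameters held fixed) are as follows. For every $n\in\{1,\dots,N+1\}$, $$\frac{\partial L}{\partial\,\mathrm{vec}(\mathbf U^{(n)}_{(l)})}=\Big(\mathbf P^{(l)}_n\frac{\partial\mathcal W^{(l)}_{(n)}}{\partial\mathbf U^{(n)}_{(l)}}\Big)^T\mathrm{vec}\big(\mathbf D^{(l)}\mathbf Z^{(l-1)T}\big),$$ where $$\frac{\partial\mathcal W^{(l)}_{(n)}}{\partial\mathbf U^{(n)}_{(l)}}=\Big((\mathbf U^{(N+1)}_{(l)}\otimes\cdots\otimes\mathbf U^{(n+1)}_{(l)}\otimes\mathbf U^{(n-1)}_{(l)}\otimes\cdots\otimes\mathbf U^{(1)}_{(l)})\,\mathcal G^{(l)T}_{(n)}\Big)\otimes\mathbf I_{I^{(l)}_n}$$ and $\mathbf P^{(l)}_n$ is the permutation matrix with $\mathrm{vec}(\mathcal T_{(N+1)})=\mathbf P^{(l)}_n\mathrm{vec}(\mathcal T_{(n)})$ for all $\mathcal T\in\mathbb R^{I^{(l)}_1\times\cdots\times I^{(l)}_{N+1}}$; in particular, for $n=N+1$, $$\frac{\partial L}{\partial\mathbf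 U^{(N+1)}_{(l)}}=\mathbf D^{(l)}\mathbf Z^{(l-1)T}\big(\mathbf U^{(N)}_{(l)}\otimes\cdots\otimes\mathbf U^{(1)}_{(l)}\big)\mathcal G^{(l)T}_{(N+1)}.$$ Moreover, $$\frac{\partial L}{\partial\mathcal G^{(l)}_{(N+1)}}=\mathbf U^{(N+1)T}_{(l)}\mathbf D^{(l)}\mathbf Z^{(l-1)T}\big(\mathbf U^{(N)}_{(l)}\otimes\cdots\otimes\mathbf U^{(1)}_{(l)}\big),\qquad \frac{\partial L}{\partial\mathbf b^{(l)}}=\big(\mathbf 1_M^T\otimes\mathbf I_{I^{(l)}_{N+1}}\big)\mathrm{vec}(\mathbf D^{(l)}).$$
   Context: Little-endian convention: multi-indices are linearized as $\overline{i_1i_2\cdots i_K}=i_1+(i_2-1)I_1+(i_3-1)I_1I_2+\cdots$ (first index varies fastest). For a tensor $\mathcal T\in\mathbb R^{I_1\times\cdots\times I_K}$, $\mathrm{vec}(\mathcal T)\in\mathbb R^{I_1\cdots I_K}$ has entry $t_{i_1\cdots i_K}$ at position $\overline{i_1\cdots i_K}$ (for matrices: column stacking). The mode-$n$ unfolding $\mathcal T_{(n)}\in\mathbb R^{I_n\times I_1\cdots I_{n-1}I_{n+1}\cdots I_K}$ has entries $(\mathcal T_{(n)})_{i_n,\overline{i_1\cdots i_{n-1}i_{n+1}\cdots i_K}}=t_{i_1\cdots i_K}$. $\mathcal W^{(l)}_{(n)}$ and $\mathcal G^{(l)}_{(n)}$ denote the mode-$n$ unfoldings of $\mathcal W^{(l)}$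 and $\mathcal G^{(l)}$, and a superscript $T$ on them denotes matrix transpose. The mode-$n$ product of $\mathcal G\in\mathbb R^{R_1\times\cdots\times R_K}$ with a matrix $\mathbf U\in\mathbb R^{I_n\times R_n}$ is $(\mathcal G\times_n\mathbf U)_{r_1\cdots r_{n-1}\,i_n\,r_{n+1}\cdots r_K}=\sum_{r_n}g_{r_1\cdots r_K}u_{i_nr_n}$. $\otimes$ is the Kronecker product ($(\mathbf A\otimes\mathbf B)_{P(r-1)+v,\,Q(s-1)+w}=a_{rs}b_{vw}$ for $\mathbf B\in\mathbb R^{P\times Q}$), $\odot$ is the entrywise (Hadamard) product, $\mathbf I_m$ is the $m\times m$ identity matrix, and $\mathbf 1_M\in\mathbb R^M$ is the all-ones column vector. For a scalar $L$ and a matrix variable $\mathbf V$, $\frac{\partial L}{\partial\mathbf V}$ is the matrix of the same size as $\mathbf V$ of entrywise partial derivatives, and $\frac{\partial L}{\partial\,\mathrm{vec}(\mathbf V)}=\mathrm{vec}\big(\frac{\partial L}{\partial\mathbf V}\big)$. For a matrix-valued function $\mathbf Y$ of a matrix $\mathbf V$, $\frac{\partial\mathbf Y}{\partial\mathbf V}$ is the Jacobian matrix of $\mathrm{vec}(\mathbf Y)$ with respect to $\mathrm{vec}(\mathbf V)$. $\frac{\partial L}{\partial\mathbf F^{(\Lambda)}}$ is the gradient of $L$ viewed as a function of $\mathbf F^{(\Lambda)}$ through $\mathbf Z^{(\Lambda)}=\sigma(\mathbf F^{(\Lambda)})$. *)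

theory Defs
  imports "HOL-Analysis.Derivative" "HOL-Combinatorics.Permutations" "Jordan_Normal_Form.Matrix"
begin

unbundle no vec_syntax


section \<open>Tensors\<close>

text \<open>
  A tensor of order \<open>K\<close> with dimensions \<open>ds\<close> (a list of length \<open>K\<close>) is a function on
  multi-indices, which are lists \<open>ix\<close> with \<open>list_all2 (<) ix ds\<close>; values elsewhere are irrelevant.
  Modes and layers are numbered from 1, index values from 0 (as rows and columns of matrices are).
\<close>

type_synonym tensor = "nat list \<Rightarrow> real"

definition dims :: "nat \<Rightarrow> (nat \<Rightarrow> nat) \<Rightarrow> nat list" where
  "dims K d = map d [1..<Suc K]"

definition lin_index :: "nat list \<Rightarrow> nat list \<Rightarrow> nat" where
  "lin_index ds ix = (\<Sum>k<length ds. ix ! k * prod_list (take k ds))"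

text \<open>The inverse of \<^const>\<open>lin_index\<close>, see \<open>lin_index_multi_index\<close> and
  \<open>multi_index_lin_index\<close> below.\<close>

definition multi_index :: "nat list \<Rightarrow> nat \<Rightarrow> nat list" where
  "multi_index ds j = map (\<lambda>k. j div prod_list (take k ds) mod ds ! k) [0..<length ds]"

definition vec_tensor :: "nat list \<Rightarrow> tensor \<Rightarrow> real vec" where
  "vec_tensor ds T = vec (prod_list ds) (\<lambda>j. T (multi_index ds j))"

definition del_mode :: "nat \<Rightarrow> nat list \<Rightarrow> nat list" where
  "del_mode n xs = take (n - 1) xs @ drop n xs"

definition ins_mode :: "nat \<Rightarrow> nat \<Rightarrow> nat list \<Rightarrow> nat list" where
  "ins_mode n i xs = take (n - 1) xs @ i # drop (n - 1) xs"

definition unfold :: "nat list \<Rightarrow> nat \<Rightarrow> tensor \<Rightarrow> real mat" where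
  "unfold ds n T = mat (ds ! (n - 1)) (prod_list (del_mode n ds))
     (\<lambda>(i, j). T (ins_mode n i (multi_index (del_mode n ds) j)))"

text \<open>The tensor with a given mode-\<open>n\<close> unfolding.\<close>

definition refold :: "nat list \<Rightarrow> nat \<Rightarrow> real mat \<Rightarrow> tensor" where
  "refold ds n V = (\<lambda>ix. V $$ (ix ! (n - 1), lin_index (del_mode n ds) (del_mode n ix)))"

definition mode_prod :: "nat \<Rightarrow> tensor \<Rightarrow> real mat \<Rightarrow> tensor" where
  "mode_prod n G U = (\<lambda>ix. \<Sum>r<dim_col U. G (ix[n - 1 := r]) * U $$ (ix ! (n - 1), r))"

definition tucker :: "nat \<Rightarrow> tensor \<Rightarrow> (nat \<Rightarrow> real mat) \<Rightarrow> tensor" where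
  "tucker K G U = fold (\<lambda>n T. mode_prod n T (U n)) [1..<Suc K] G"


section \<open>Matrices\<close>

definition vec_mat :: "real mat \<Rightarrow> real vec" where
  "vec_mat A = vec (dim_row A * dim_col A) (\<lambda>k. A $$ (k mod dim_row A, k div dim_row A))"

definition kron :: "real mat \<Rightarrow> real mat \<Rightarrow> real mat" where
  "kron A B = mat (dim_row A * dim_row B) (dim_col A * dim_col B)
     (\<lambda>(i, j). A $$ (i div dim_row B, j div dim_col B) * B $$ (i mod dim_row B, j mod dim_col B))"

text \<open>\<open>kron_rev U [n\<^sub>1, \<dots>, n\<^sub>k]\<close> is the Kronecker product of \<open>U n\<^sub>k, \<dots>, U n\<^sub>1\<close> in this order.\<close>

definition kron_rev :: "(nat \<Rightarrow> real mat) \<Rightarrow> nat list \<Rightarrow> real mat" where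
  "kron_rev U ns = foldr kron (map U (rev ns)) (1\<^sub>m 1)"

definition hadamard :: "real mat \<Rightarrow> real mat \<Rightarrow> real mat" where
  "hadamard A B = mat (dim_row A) (dim_col A) (\<lambda>ij. A $$ ij * B $$ ij)"

definition ones_row :: "nat \<Rightarrow> real mat" where
  "ones_row m = mat 1 m (\<lambda>_. 1)"

definition permutation_mat :: "nat \<Rightarrow> real mat \<Rightarrow> bool" where
  "permutation_mat m P \<longleftrightarrow>
     (\<exists>p. p permutes {..<m} \<and> P = mat m m (\<lambda>(i, j). if j = p i then 1 else 0))"

text \<open>\<open>P\<close> turns the vectorized mode-\<open>n\<close> unfolding into the vectorized last-mode unfolding.\<close>

definition unfold_permutation :: "nat list \<Rightarrow> nat \<Rightarrow> real mat \<Rightarrow> bool" where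
  "unfold_permutation ds n P \<longleftrightarrow> permutation_mat (prod_list ds) P \<and>
     (\<forall>T. vec_mat (unfold ds (length ds) T) = P *\<^sub>v vec_mat (unfold ds n T))"


section \<open>Derivatives with respect to matrices and vectors\<close>

text \<open>
  The carrier types of the matrix library are not normed spaces, so Frechet differentiability on
  the space of matrices with the dimensions of \<open>Z\<close> is spelled out with the Frobenius norm; the
  derivative is the linear functional \<open>\<lambda>H. vec A \<bullet> vec H\<close>.
\<close>

definition frob_norm :: "real mat \<Rightarrow> real" where
  "frob_norm H = sqrt (scalar_prod (vec_mat H) (vec_mat H))"

definition mat_differentiable :: "(real mat \<Rightarrow> real) \<Rightarrow> real mat \<Rightarrow> bool" where
  "mat_differentiable f Z \<longleftrightarrow>
     (\<exists>A \<in> carrier_mat (dim_row Z) (dim_col Z). \<forall>e>0. \<exists>d>0.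
        \<forall>H \<in> carrier_mat (dim_row Z) (dim_col Z). frob_norm H < d \<longrightarrow>
          \<bar>f (Z + H) - f Z - scalar_prod (vec_mat A) (vec_mat H)\<bar> \<le> e * frob_norm H)"

text \<open>Since \<^const>\<open>deriv\<close> is total, existence of the partial derivatives is a separate predicate.\<close>

definition mat_partials_exist :: "(real mat \<Rightarrow> real) \<Rightarrow> real mat \<Rightarrow> bool" where
  "mat_partials_exist f V \<longleftrightarrow> (\<forall>i<dim_row V. \<forall>j<dim_col V.
     (\<lambda>t. f (V |\<^sub>m (i, j) \<mapsto> t)) differentiable (at (V $$ (i, j))))"

definition mat_grad :: "(real mat \<Rightarrow> real) \<Rightarrow> real mat \<Rightarrow> real mat" where
  "mat_grad f V = mat (dim_row V) (dim_col V)
     (\<lambda>(i, j). deriv (\<lambda>t. f (V |\<^sub>m (i, j) \<mapsto> t)) (V $$ (i, j)))"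

definition vec_partials_exist :: "(real vec \<Rightarrow> real) \<Rightarrow> real vec \<Rightarrow> bool" where
  "vec_partials_exist f v \<longleftrightarrow> (\<forall>i<dim_vec v.
     (\<lambda>t. f (v |\<^sub>v i \<mapsto> t)) differentiable (at (v $ i)))"

definition vec_grad :: "(real vec \<Rightarrow> real) \<Rightarrow> real vec \<Rightarrow> real vec" where
  "vec_grad f v = vec (dim_vec v) (\<lambda>i. deriv (\<lambda>t. f (v |\<^sub>v i \<mapsto> t)) (v $ i))"

text \<open>The Jacobian matrix of \<open>vec (Y V)\<close> with respect to \<open>vec V\<close>: row \<open>p\<close> is the vectorized
  gradient of the \<open>p\<close>-th entry of \<open>vec (Y V)\<close>.\<close>

definition mat_jacobian :: "(real mat \<Rightarrow> real mat) \<Rightarrow> real mat \<Rightarrow> real mat" where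
  "mat_jacobian Y V = mat (dim_vec (vec_mat (Y V))) (dim_vec (vec_mat V))
     (\<lambda>(p, q). vec_mat (mat_grad (\<lambda>X. vec_mat (Y X) $ p) V) $ q)"

definition mat_jacobian_exists :: "(real mat \<Rightarrow> real mat) \<Rightarrow> real mat \<Rightarrow> bool" where
  "mat_jacobian_exists Y V \<longleftrightarrow>
     (\<forall>p<dim_vec (vec_mat (Y V)). mat_partials_exist (\<lambda>X. vec_mat (Y X) $ p) V)"


section \<open>The network\<close>

definition weight_mat ::
  "nat \<Rightarrow> (nat \<Rightarrow> nat \<Rightarrow> nat) \<Rightarrow> (nat \<Rightarrow> tensor) \<Rightarrow> (nat \<Rightarrow> nat \<Rightarrow> real mat) \<Rightarrow> nat \<Rightarrow> real mat" where
  "weight_mat N I G U l = unfold (dims (N + 1) (I l)) (N + 1) (tucker (N + 1) (G l) (U l))"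

definition pre_activation :: "real mat \<Rightarrow> real vec \<Rightarrow> real mat \<Rightarrow> real mat" where
  "pre_activation A b Z = A * Z + mat_of_cols (dim_vec b) [b] * ones_row (dim_col Z)"

primrec layer_out ::
  "nat \<Rightarrow> (nat \<Rightarrow> nat \<Rightarrow> nat) \<Rightarrow> (real \<Rightarrow> real) \<Rightarrow> real mat \<Rightarrow>
   (nat \<Rightarrow> tensor) \<Rightarrow> (nat \<Rightarrow> nat \<Rightarrow> real mat) \<Rightarrow> (nat \<Rightarrow> real vec) \<Rightarrow> nat \<Rightarrow> real mat" where
  "layer_out N I \<sigma> Z0 G U b 0 = Z0"
| "layer_out N I \<sigma> Z0 G U b (Suc l) =
     map_mat \<sigma> (pre_activation (weight_mat N I G U (Suc l)) (b (Suc l)) (layer_out N I \<sigma> Z0 G U b l))"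


section \<open>Index conventions\<close>

lemma lin_index_Nil [simp]: "lin_index [] ix = 0"
  by (simp add: lin_index_def)

lemma lin_index_Cons [simp]: "lin_index (d # ds) (i # ix) = i + d * lin_index ds ix"
  unfolding lin_index_def length_Cons sum.lessThan_Suc_shift
  by (simp add: sum_distrib_left mult_ac)

lemma multi_index_Nil [simp]: "multi_index [] j = []"
  by (simp add: multi_index_def)

lemma multi_index_Cons [simp]:
  "multi_index (d # ds) j = (j mod d) # multi_index ds (j div d)"
  unfolding multi_index_def length_Cons upt_conv_Cons[OF zero_less_Suc] map_Suc_upt[symmetric]
  by (simp add: div_mult2_eq)

lemma lin_index_less: "list_all2 (<) ix ds \<Longrightarrow> lin_index ds ix < prod_list ds"
proof (induction rule: list_all2_induct)
  case (Cons i ix d ds)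
  then have "i + d * lin_index ds ix < d + d * lin_index ds ix" by simp
  also have "\<dots> = d * Suc (lin_index ds ix)" by simp
  also have "\<dots> \<le> d * prod_list ds" using Cons by (intro mult_le_mono2) simp
  finally show ?case by simp
qed simp

lemma multi_index_lin_index: "list_all2 (<) ix ds \<Longrightarrow> multi_index ds (lin_index ds ix) = ix"
  by (induction rule: list_all2_induct) auto

lemma multi_index_valid: "j < prod_list ds \<Longrightarrow> list_all2 (<) (multi_index ds j) ds"
proof (induction ds arbitrary: j)
  case (Cons d ds)
  then have "j div d < prod_list ds" and "0 < d"
    by (auto simp: less_mult_imp_div_less mult.commute intro: gr0I)
  then show ?case using Cons.IH by simp
qed simp

lemma lin_index_multi_index: "j < prod_list ds \<Longrightarrow> lin_index ds (multi_index ds j) = j"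
proof (induction ds arbitrary: j)
  case (Cons d ds)
  then have "j div d < prod_list ds"
    by (simp add: less_mult_imp_div_less mult.commute)
  then show ?case using Cons.IH by simp
qed simp

lemma list_all2_del_mode: "list_all2 (<) ix ds \<Longrightarrow> list_all2 (<) (del_mode n ix) (del_mode n ds)"
  unfolding del_mode_def by (intro list_all2_appendI list_all2_takeI list_all2_dropI)

lemma ins_del_mode:
  "1 \<le> n \<Longrightarrow> n \<le> length ix \<Longrightarrow> ins_mode n (ix ! (n - 1)) (del_mode n ix) = ix"
  unfolding ins_mode_def del_mode_def
  by (cases n) (auto simp: min_def drop_take id_take_nth_drop[symmetric])

lemma unfold_entry:
  assumes "list_all2 (<) ix ds" and "1 \<le> n" and "n \<le> length ds"
  shows "unfold ds n T $$ (ix ! (n - 1), lin_index (del_mode n ds) (del_mode n ix)) = T ix"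
proof -
  have "length ix = length ds" using assms(1) by (rule list_all2_lengthD)
  then have "ins_mode n (ix ! (n - 1)) (del_mode n ix) = ix" using assms by (intro ins_del_mode) auto
  moreover have "ix ! (n - 1) < ds ! (n - 1)"
    using assms by (auto simp: list_all2_conv_all_nth)
  moreover note lin_index_less[OF list_all2_del_mode[OF assms(1)], of n]
  ultimately show ?thesis using assms
    by (simp add: unfold_def multi_index_lin_index list_all2_del_mode)
qed

lemma refold_unfold:
  assumes "list_all2 (<) ix ds" and "1 \<le> n" and "n \<le> length ds"
  shows "refold ds n (unfold ds n T) ix = T ix"
  using unfold_entry[OF assms] by (simp add: refold_def)

end

(*
  Along a curve of parameters of layer l, the pairing of D k with the derivative of the
  pre-activation F k is the same for all k >= l, because the recursion for D is the adjoint of the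
  forward propagation of tangent vectors; at the output layer the pairing is the derivative of the
  loss.  So the gradient with respect to W l is D l * Z (l - 1)^T.  The mode-n unfolding of a Tucker
  product is linear in the factor of mode n, with matrix G_(n) times a transposed Kronecker product
  of the remaining factors, and this turns the gradient with respect to W l into the gradients with
  respect to the factors and the core.
*)

theory Submission
  imports Defs
begin

text \<open>A gradient entry is the derivative of a function of one real variable, along the
  coordinate curve \<open>V |\<^sub>m (i, j) \<mapsto> t\<close>. The obstacle is composition:
  moving one parameter entry moves many entries of the output at once, and partial derivatives of
  \<open>L\<close> alone do not determine its rate of change along such a curve. Frechet
  differentiability of \<open>L\<close> therefore enters at the output layer, for arbitrary curves
  of matrices; below it, every derivative is that of a finite sum of scalar functions. The second
  difficulty is a clash of modes: the factor \<open>U l n\<close> stands on the left of a matrix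
  product in the mode-n unfolding of the weight tensor, while the network reads this tensor in mode
  \<open>N + 1\<close>. The derivative is computed in mode n, folded back to a tensor by
  \<open>refold\<close> and unfolded again in the last mode. The matrix \<open>P\<close> of the
  theorem is this change of mode, written on vectorizations.\<close>

\<comment> \<open>keeps the position \<open>n - 1\<close> of mode \<open>n\<close> in the form that the definitions use\<close>
declare One_nat_def [simp del]

section \<open>Multi-indices with one mode singled out\<close>

lemma length_del_mode: "1 \<le> n \<Longrightarrow> n \<le> length xs \<Longrightarrow> length (del_mode n xs) = length xs - 1"
  by (auto simp: del_mode_def)

lemma length_ins_mode [simp]: "length (ins_mode n i xs) = Suc (length xs)"
  by (simp add: ins_mode_def)

lemma nth_ins_mode_same: "n - 1 \<le> length xs \<Longrightarrow> ins_mode n i xs ! (n - 1) = i"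
  by (simp add: ins_mode_def nth_append min_def)

lemma del_ins_mode: "1 \<le> n \<Longrightarrow> n - 1 \<le> length xs \<Longrightarrow> del_mode n (ins_mode n i xs) = xs"
  by (cases n) (auto simp: ins_mode_def del_mode_def min_def)

lemma map_del_mode: "map f (del_mode n xs) = del_mode n (map f xs)"
  by (simp add: del_mode_def take_map drop_map)

lemma nth_del_mode:
  assumes "1 \<le> n" "n \<le> length xs" "k < length xs - 1"
  shows "del_mode n xs ! k = xs ! (if k < n - 1 then k else Suc k)"
  using assms by (auto simp: del_mode_def nth_append min_def One_nat_def)

lemma list_all2_ins_mode:
  assumes "1 \<le> n" "n \<le> length ds" "i < ds ! (n - 1)" "list_all2 (<) xs (del_mode n ds)"
  shows "list_all2 (<) (ins_mode n i xs) ds"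
proof -
  have ds: "ds = ins_mode n (ds ! (n - 1)) (del_mode n ds)"
    using assms by (simp add: ins_del_mode)
  show ?thesis
    by (subst ds, unfold ins_mode_def)
      (intro list_all2_appendI list_all2_takeI list_all2_dropI list.rel_intros assms)
qed

lemma prod_list_del_mode:
  assumes "1 \<le> n" "n \<le> length ds"
  shows "ds ! (n - 1) * prod_list (del_mode n ds) = prod_list ds"
proof -
  have "prod_list ds = prod_list (ins_mode n (ds ! (n - 1)) (del_mode n ds))"
    using assms by (simp add: ins_del_mode)
  also have "\<dots> = ds ! (n - 1) * (prod_list (take (n - 1) (del_mode n ds)) * prod_list (drop (n - 1) (del_mode n ds)))"
    by (simp add: ins_mode_def)
  also have "\<dots> = ds ! (n - 1) * prod_list (del_mode n ds)"
    by (simp flip: prod_list.append)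
  finally show ?thesis ..
qed

text \<open>The shift matches \<open>nth_del_mode\<close>: it enumerates all positions below K
  except m, so the factors left over run through the positions of a list from which one mode has
  been deleted.\<close>

lemma prod_skip:
  fixes f :: "nat \<Rightarrow> 'a::comm_monoid_mult"
  assumes "m < K"
  shows "prod f {..<K} = f m * (\<Prod>k<K - 1. f (if k < m then k else Suc k))"
proof -
  let ?s = "\<lambda>k. if k < m then k else Suc k"
  have "x \<in> ?s ` {..<K - 1}" if "x < K" "x \<noteq> m" for x
    using that assms by (intro image_eqI[where x = "if x < m then x else x - 1"]) auto
  then have "?s ` {..<K - 1} = {..<K} - {m}"
    using assms by (auto split: if_splits)
  moreover have "inj_on ?s {..<K - 1}"
    by (auto simp: inj_on_def split: if_splits)
  ultimately have "prod f ({..<K} - {m}) = (\<Prod>k<K - 1. f (?s k))"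
    by (metis (no_types, lifting) prod.reindex_cong)
  then show ?thesis using assms by (simp add: prod.remove)
qed

text \<open>Rows and columns of the mode-n unfolding together parametrize all multi-indices, so a
  sum over multi-indices becomes a double sum over matrix positions.\<close>

lemma bij_betw_ins_mode:
  assumes "1 \<le> n" "n \<le> length ds"
  shows "bij_betw (\<lambda>(i, j). ins_mode n i (multi_index (del_mode n ds) j))
           ({..<ds ! (n - 1)} \<times> {..<prod_list (del_mode n ds)}) {ix. list_all2 (<) ix ds}"
proof (rule bij_betw_byWitness[where f' = "\<lambda>ix. (ix ! (n - 1), lin_index (del_mode n ds) (del_mode n ix))"])
  have len: "length (multi_index (del_mode n ds) j) = length ds - 1" for j
    using assms by (simp add: multi_index_def length_del_mode)
  show "\<forall>ij\<in>{..<ds ! (n - 1)} \<times> {..<prod_list (del_mode n ds)}.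
      (\<lambda>ix. (ix ! (n - 1), lin_index (del_mode n ds) (del_mode n ix)))
        ((\<lambda>(i, j). ins_mode n i (multi_index (del_mode n ds) j)) ij) = ij"
    using assms len by (auto simp: nth_ins_mode_same del_ins_mode lin_index_multi_index)
  show "\<forall>ix\<in>{ix. list_all2 (<) ix ds}.
      (\<lambda>(i, j). ins_mode n i (multi_index (del_mode n ds) j))
        (ix ! (n - 1), lin_index (del_mode n ds) (del_mode n ix)) = ix"
    using assms by (auto simp: multi_index_lin_index list_all2_del_mode ins_del_mode dest: list_all2_lengthD)
  show "(\<lambda>(i, j). ins_mode n i (multi_index (del_mode n ds) j)) `
      ({..<ds ! (n - 1)} \<times> {..<prod_list (del_mode n ds)}) \<subseteq> {ix. list_all2 (<) ix ds}"
    using assms by (auto intro!: list_all2_ins_mode multi_index_valid)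
  show "(\<lambda>ix. (ix ! (n - 1), lin_index (del_mode n ds) (del_mode n ix))) ` {ix. list_all2 (<) ix ds}
      \<subseteq> {..<ds ! (n - 1)} \<times> {..<prod_list (del_mode n ds)}"
    using assms by (auto simp: list_all2_conv_all_nth intro!: lin_index_less[OF list_all2_del_mode])
qed

text \<open>\<open>multi_index_Cons\<close> peels off the least significant digit. Kronecker
  products grow at the other end, where a new leftmost factor owns the most significant digit, and
  this is the recursion that they need.\<close>

lemma multi_index_snoc:
  assumes "j < prod_list ds * d"
  shows "multi_index (ds @ [d]) j = multi_index ds (j mod prod_list ds) @ [j div prod_list ds]"
  using assms
proof (induction ds arbitrary: j)
  case (Cons e ds)
  have lt: "j div e < prod_list ds * d"
    using Cons.prems by (intro less_mult_imp_div_less) (simp add: mult_ac)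
  have "j mod (e * prod_list ds) mod e = j mod e"
    by (simp add: mod_mod_cancel)
  moreover have "j mod (e * prod_list ds) div e = j div e mod prod_list ds"
    by (cases "e = 0") (simp_all add: mod_mult2_eq)
  ultimately show ?case using Cons.IH[OF lt] by (simp add: div_mult2_eq)
qed simp

section \<open>The unfoldings of a Tucker product\<close>

lemma list_all2_less_snoc:
  "{rs. list_all2 (<) rs (ds @ [d])} = (\<lambda>(rs, r). rs @ [r]) ` ({rs. list_all2 (<) rs ds} \<times> {..<d::nat})"
proof (intro equalityI subsetI)
  fix xs assume "xs \<in> {rs. list_all2 (<) rs (ds @ [d])}"
  then obtain us v where "xs = us @ [v]" "list_all2 (<) us ds" "v < d"
    by (auto simp: list_all2_append2 list_all2_Cons2)
  then show "xs \<in> (\<lambda>(rs, r). rs @ [r]) ` ({rs. list_all2 (<) rs ds} \<times> {..<d})" by auto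
qed (auto intro: list_all2_appendI)

lemma dims_Suc: "dims (Suc k) d = dims k d @ [d (Suc k)]"
  by (simp add: dims_def)

lemma length_dims [simp]: "length (dims k d) = k"
  by (simp add: dims_def)

lemma nth_dims: "k < K \<Longrightarrow> dims K d ! k = d (Suc k)"
  by (simp add: dims_def One_nat_def del: upt_Suc)

text \<open>Truncating at k makes the induction work: the first k indices of the core are summed
  over, while the remaining ones are still the indices of \<open>xs\<close> itself.\<close>

lemma tucker_entry:
  assumes "k \<le> length xs"
  shows "tucker k G U xs = (\<Sum>rs | list_all2 (<) rs (dims k (\<lambda>n. dim_col (U n))).
           G (rs @ drop k xs) * (\<Prod>j<k. U (Suc j) $$ (xs ! j, rs ! j)))"
  using assms
proof (induction k arbitrary: xs)
  case 0
  then show ?case by (simp add: tucker_def dims_def)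
next
  case (Suc k)
  let ?V = "{rs. list_all2 (<) rs (dims k (\<lambda>n. dim_col (U n)))}"
  have inj: "inj_on (\<lambda>(rs, r). rs @ [r]) (?V \<times> {..<dim_col (U (Suc k))})"
    by (auto simp: inj_on_def)
  have "tucker (Suc k) G U xs = (\<Sum>r<dim_col (U (Suc k)). tucker k G U (xs[k := r]) * U (Suc k) $$ (xs ! k, r))"
    by (simp add: tucker_def mode_prod_def)
  also have "\<dots> = (\<Sum>r<dim_col (U (Suc k)). \<Sum>rs\<in>?V.
      G (rs @ r # drop (Suc k) xs) * (\<Prod>j<k. U (Suc j) $$ (xs ! j, rs ! j)) * U (Suc k) $$ (xs ! k, r))"
  proof (rule sum.cong[OF refl])
    fix r
    \<comment> \<open>The index chosen by the outermost mode product becomes the head of the part of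
      \<open>xs\<close> that the first k sums leave untouched.\<close>
    have "drop k (xs[k := r]) = r # drop (Suc k) xs"
      using Suc.prems by (simp add: Cons_nth_drop_Suc[symmetric])
    then show "tucker k G U (xs[k := r]) * U (Suc k) $$ (xs ! k, r) = (\<Sum>rs\<in>?V.
      G (rs @ r # drop (Suc k) xs) * (\<Prod>j<k. U (Suc j) $$ (xs ! j, rs ! j)) * U (Suc k) $$ (xs ! k, r))"
      using Suc.prems by (simp add: Suc.IH sum_distrib_right)
  qed
  also have "\<dots> = (\<Sum>(rs, r)\<in>?V \<times> {..<dim_col (U (Suc k))}.
      G (rs @ r # drop (Suc k) xs) * (\<Prod>j<k. U (Suc j) $$ (xs ! j, rs ! j)) * U (Suc k) $$ (xs ! k, r))"
    by (subst sum.swap) (simp add: sum.cartesian_product)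
  also have "\<dots> = (\<Sum>rs | list_all2 (<) rs (dims (Suc k) (\<lambda>n. dim_col (U n))).
           G (rs @ drop (Suc k) xs) * (\<Prod>j<Suc k. U (Suc j) $$ (xs ! j, rs ! j)))"
    unfolding dims_Suc list_all2_less_snoc sum.reindex[OF inj]
    by (intro sum.cong refl) (auto simp: nth_append dest: list_all2_lengthD)
  finally show ?case .
qed

section \<open>Entries of iterated Kronecker products\<close>

lemma kron_carrier [intro]:
  "A \<in> carrier_mat a b \<Longrightarrow> B \<in> carrier_mat c d \<Longrightarrow> kron A B \<in> carrier_mat (a * c) (b * d)"
  by (auto simp: kron_def)

lemma kron_rev_snoc: "kron_rev U (ns @ [n]) = kron (U n) (kron_rev U ns)"
  by (simp add: kron_rev_def)

lemma kron_rev_carrier: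
  assumes "\<And>n. n \<in> set ns \<Longrightarrow> U n \<in> carrier_mat (a n) (b n)"
  shows "kron_rev U ns \<in> carrier_mat (prod_list (map a ns)) (prod_list (map b ns))"
  using assms
proof (induction ns rule: rev_induct)
  case Nil
  show ?case by (simp add: kron_rev_def)
next
  case (snoc n ns)
  then have "kron (U n) (kron_rev U ns) \<in> carrier_mat (a n * prod_list (map a ns)) (b n * prod_list (map b ns))"
    by (intro kron_carrier) auto
  then show ?case by (simp add: kron_rev_snoc mult.commute)
qed

text \<open>Row and column numbers are read in mixed radix, one digit per factor. The quotient and
  remainder in the definition of \<open>kron\<close> are exactly the split of
  \<open>multi_index_snoc\<close>.\<close>

lemma kron_rev_entry:
  assumes "\<And>n. n \<in> set ns \<Longrightarrow> U n \<in> carrier_mat (a n) (b n)"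
    and "i < prod_list (map a ns)" "j < prod_list (map b ns)"
  shows "kron_rev U ns $$ (i, j) =
    (\<Prod>k<length ns. U (ns ! k) $$ (multi_index (map a ns) i ! k, multi_index (map b ns) j ! k))"
  using assms
proof (induction ns arbitrary: i j rule: rev_induct)
  case Nil
  then show ?case by (simp add: kron_rev_def)
next
  case (snoc n ns)
  let ?p = "prod_list (map a ns)" and ?q = "prod_list (map b ns)"
  have K: "kron_rev U ns \<in> carrier_mat ?p ?q" using snoc.prems by (intro kron_rev_carrier) auto
  have n: "U n \<in> carrier_mat (a n) (b n)" using snoc.prems by auto
  \<comment> \<open>An index below the full product rules out zero dimensions, so the remainders
    below stay in range for the induction hypothesis.\<close>
  have pos: "?p > 0" "?q > 0" using snoc.prems by (auto intro!: gr0I)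
  have len: "length (multi_index (map a ns) k) = length ns" "length (multi_index (map b ns) k) = length ns" for k
    by (simp_all add: multi_index_def)
  have "kron_rev U (ns @ [n]) $$ (i, j) = U n $$ (i div ?p, j div ?q) * kron_rev U ns $$ (i mod ?p, j mod ?q)"
    using carrier_matD[OF K] carrier_matD[OF n] snoc.prems(2,3)
    by (simp add: kron_rev_snoc kron_def mult.commute)
  also have "kron_rev U ns $$ (i mod ?p, j mod ?q) =
      (\<Prod>k<length ns. U (ns ! k) $$ (multi_index (map a ns) (i mod ?p) ! k, multi_index (map b ns) (j mod ?q) ! k))"
    using snoc.prems pos by (intro snoc.IH) auto
  finally show ?case
    using snoc.prems by (simp add: multi_index_snoc nth_append len mult.commute)
qed

lemma unfold_carrier:
  "unfold ds n T \<in> carrier_mat (ds ! (n - 1)) (prod_list (del_mode n ds))"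
  by (simp add: unfold_def)

text \<open>In this list the number n occurs only at position n - 1. Unfoldings delete a mode by
  position and the Kronecker products of the theorem by value; here the two descriptions
  meet.\<close>

lemma del_mode_upt: "1 \<le> n \<Longrightarrow> n \<le> K \<Longrightarrow> del_mode n [1..<Suc K] = removeAll n [1..<Suc K]"
proof -
  assume n: "1 \<le> n" "n \<le> K"
  have 1: "[1..<Suc K] = [1..<n] @ n # [Suc n..<Suc K]"
    using n upt_add_eq_append[of 1 n "Suc K - n"] upt_conv_Cons[of n "Suc K"] by (simp del: upt_Suc)
  show ?thesis unfolding 1 using n by (simp add: del_mode_def One_nat_def del: upt_Suc)
qed

lemma del_mode_dims: "1 \<le> n \<Longrightarrow> n \<le> K \<Longrightarrow> del_mode n (dims K d) = map d (removeAll n [1..<Suc K])"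
  by (simp only: dims_def map_del_mode[symmetric] del_mode_upt)

text \<open>In \<open>tucker_entry\<close> the factor of mode n depends only on the row and on one
  core index; all other factors combine into one entry of the Kronecker product. The bracketing
  shows the linearity in \<open>U n\<close> and, in the inner product, the linearity in the
  core.\<close>

lemma unfold_tucker:
  assumes n: "1 \<le> n" "n \<le> K" and U: "\<And>m. m \<in> {1..K} \<Longrightarrow> U m \<in> carrier_mat (I m) (R m)"
  shows "unfold (dims K I) n (tucker K G U) =
    U n * (unfold (dims K R) n G * (kron_rev U (removeAll n [1..<Suc K]))\<^sup>T)"
proof (rule eq_matI)
  let ?ns = "removeAll n [1..<Suc K]" and ?p = "prod_list (del_mode n (dims K I))"
  let ?q = "prod_list (del_mode n (dims K R))"
  have Un: "U n \<in> carrier_mat (I n) (R n)" using n U by auto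
  have kr: "kron_rev U ?ns \<in> carrier_mat ?p ?q"
    using U n unfolding del_mode_dims[OF n] by (intro kron_rev_carrier) (auto simp del: upt_Suc)
  have dn: "dims K d ! (n - 1) = d n" for d :: "nat \<Rightarrow> nat" using n by (cases n) (auto simp: nth_dims)
  have G: "unfold (dims K R) n G \<in> carrier_mat (R n) ?q"
    using unfold_carrier[of "dims K R" n G] by (simp add: dn)
  have lns: "length ?ns = K - 1" using n by (simp add: del_mode_upt[symmetric] length_del_mode del: upt_Suc)
  show "dim_row (unfold (dims K I) n (tucker K G U)) = dim_row (U n * (unfold (dims K R) n G * (kron_rev U ?ns)\<^sup>T))"
    "dim_col (unfold (dims K I) n (tucker K G U)) = dim_col (U n * (unfold (dims K R) n G * (kron_rev U ?ns)\<^sup>T))"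
    using Un kr by (auto simp: unfold_def dn)
  fix i c assume "i < dim_row (U n * (unfold (dims K R) n G * (kron_rev U ?ns)\<^sup>T))"
    "c < dim_col (U n * (unfold (dims K R) n G * (kron_rev U ?ns)\<^sup>T))"
  then have i: "i < I n" and c: "c < ?p" using Un kr by auto
  let ?xs = "multi_index (del_mode n (dims K I)) c"
  let ?rs = "multi_index (del_mode n (dims K R))"
  have lx: "length ?xs = K - 1" and lr: "length (?rs q) = K - 1" for q
    using n by (simp_all add: multi_index_def length_del_mode)
  have dR: "dims K (\<lambda>n. dim_col (U n)) = dims K R"
    unfolding dims_def using carrier_matD(2)[OF U] by (intro map_cong refl) (simp del: upt_Suc)
  have "unfold (dims K I) n (tucker K G U) $$ (i, c) = tucker K G U (ins_mode n i ?xs)"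
    using i c by (simp add: unfold_def dn)
  also have "\<dots> = (\<Sum>rs | list_all2 (<) rs (dims K R).
           G rs * (\<Prod>j<K. U (Suc j) $$ (ins_mode n i ?xs ! j, rs ! j)))"
    using n lx by (subst tucker_entry) (auto simp: dR)
  \<comment> \<open>The core index of mode n is separated from the others, so that the sum runs over
    rows and columns of the unfolded core.\<close>
  also have "\<dots> = (\<Sum>(r, q)\<in>{..<R n} \<times> {..<?q}. G (ins_mode n r (?rs q)) *
      (\<Prod>j<K. U (Suc j) $$ (ins_mode n i ?xs ! j, ins_mode n r (?rs q) ! j)))"
    using n sum.reindex_bij_betw[OF bij_betw_ins_mode[of n "dims K R"], symmetric]
    by (simp add: dn case_prod_unfold)
  also have "\<dots> = (\<Sum>(r, q)\<in>{..<R n} \<times> {..<?q}. U n $$ (i, r) * (unfold (dims K R) n G $$ (r, q) * kron_rev U ?ns $$ (c, q)))"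
  proof (intro sum.cong refl, clarify)
    fix r q assume r: "r < R n" and q: "q < ?q"
    have skip: "ins_mode n x ys ! (if k < n - 1 then k else Suc k) = ys ! k"
      if "k < K - 1" "length ys = K - 1" for x k and ys :: "nat list"
      using that n nth_del_mode[of n "ins_mode n x ys" k] by (simp add: del_ins_mode)
    have "(\<Prod>j<K. U (Suc j) $$ (ins_mode n i ?xs ! j, ins_mode n r (?rs q) ! j)) =
       U n $$ (i, r) * (\<Prod>k<K - 1. U (Suc (if k < n - 1 then k else Suc k)) $$ (?xs ! k, ?rs q ! k))"
      using n lx lr by (subst prod_skip[of "n - 1"]) (auto simp: nth_ins_mode_same skip intro!: prod.cong)
    also have "(\<Prod>k<K - 1. U (Suc (if k < n - 1 then k else Suc k)) $$ (?xs ! k, ?rs q ! k)) =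
       (\<Prod>k<length ?ns. U (?ns ! k) $$ (?xs ! k, ?rs q ! k))"
    proof (intro prod.cong)
      fix k assume "k \<in> {..<length ?ns}"
      then have k: "k < K - 1" by (simp only: lns lessThan_iff)
      \<comment> \<open>Positions count from 0 and modes from 1, hence the outer \<open>Suc\<close>
        around the skipped position.\<close>
      then have "?ns ! k = Suc (if k < n - 1 then k else Suc k)"
        using n nth_del_mode[of n "[1..<Suc K]" k] by (simp add: del_mode_upt del: upt_Suc split: if_splits)
      then show "U (Suc (if k < n - 1 then k else Suc k)) $$ (?xs ! k, ?rs q ! k) = U (?ns ! k) $$ (?xs ! k, ?rs q ! k)"
        by (simp only:)
    qed (simp only: lns)
    also have "\<dots> = kron_rev U ?ns $$ (c, q)"
      using kron_rev_entry[of ?ns U I R c q] U n c q by (simp add: del_mode_dims del: upt_Suc)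
    finally show "G (ins_mode n r (?rs q)) *
      (\<Prod>j<K. U (Suc j) $$ (ins_mode n i ?xs ! j, ins_mode n r (?rs q) ! j)) =
      U n $$ (i, r) * (unfold (dims K R) n G $$ (r, q) * kron_rev U ?ns $$ (c, q))"
      using r q by (simp add: unfold_def dn)
  qed
  also have "\<dots> = (\<Sum>r<R n. \<Sum>q<?q. U n $$ (i, r) * (unfold (dims K R) n G $$ (r, q) * kron_rev U ?ns $$ (c, q)))"
    by (simp add: sum.cartesian_product)
  also have "\<dots> = (U n * (unfold (dims K R) n G * (kron_rev U ?ns)\<^sup>T)) $$ (i, c)"
    using i c Un kr G by (simp add: scalar_prod_def sum_distrib_left atLeast0LessThan)
  finally show "unfold (dims K I) n (tucker K G U) $$ (i, c) = (U n * (unfold (dims K R) n G * (kron_rev U ?ns)\<^sup>T)) $$ (i, c)" .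
qed

section \<open>Vectorization\<close>

lemma bij_betw_mod_div:
  "bij_betw (\<lambda>k. (k mod n, k div n)) {..<n * m} ({..<n} \<times> {..<m::nat})"
proof (rule bij_betw_byWitness[where f' = "\<lambda>(i, j). i + n * j"])
  show "(\<lambda>(i, j). i + n * j) ` ({..<n} \<times> {..<m}) \<subseteq> {..<n * m}"
  proof clarsimp
    fix i j assume "i < n" "j < m"
    then have "i + n * j < n * Suc j" by simp
    also have "\<dots> \<le> n * m" using \<open>j < m\<close> by (intro mult_le_mono2) simp
    finally show "i + n * j < n * m" .
  qed
  show "(\<lambda>k. (k mod n, k div n)) ` {..<n * m} \<subseteq> {..<n} \<times> {..<m}"
    by (auto simp: less_mult_imp_div_less mult.commute intro!: mod_less_divisor gr0I)
qed auto

lemma sum_mod_div: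
  fixes f :: "nat \<Rightarrow> nat \<Rightarrow> 'a::comm_monoid_add"
  shows "(\<Sum>k<n * m. f (k mod n) (k div n)) = (\<Sum>i<n. \<Sum>j<m. f i j)"
  using sum.reindex_bij_betw[OF bij_betw_mod_div, of "\<lambda>(i, j). f i j" n m]
  by (simp add: sum.cartesian_product)

lemma sum_sum_delta:
  fixes f :: "nat \<Rightarrow> nat \<Rightarrow> 'a::semiring_1"
  assumes "i < n" "j < m"
  shows "(\<Sum>k<n. \<Sum>c<m. f k c * (if k = i \<and> c = j then 1 else 0)) = f i j"
proof -
  have "(\<Sum>k<n. \<Sum>c<m. f k c * (if k = i \<and> c = j then 1 else 0)) =
      (\<Sum>x\<in>{..<n} \<times> {..<m}. if x = (i, j) then f (fst x) (snd x) else 0)"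
    unfolding sum.cartesian_product by (intro sum.cong refl) (simp split: prod.splits)
  then show ?thesis using assms by (simp add: sum.delta)
qed

lemma vec_mat_index:
  "A \<in> carrier_mat n m \<Longrightarrow> k < n * m \<Longrightarrow> vec_mat A $ k = A $$ (k mod n, k div n)"
  by (simp add: vec_mat_def)

lemma dim_vec_mat: "A \<in> carrier_mat n m \<Longrightarrow> dim_vec (vec_mat A) = n * m"
  by (simp add: vec_mat_def)

lemma scalar_prod_vec_mat:
  assumes "A \<in> carrier_mat n m" "B \<in> carrier_mat n m"
  shows "vec_mat A \<bullet> vec_mat B = (\<Sum>i<n. \<Sum>j<m. A $$ (i, j) * B $$ (i, j))"
  unfolding sum_mod_div[symmetric] using assms
  by (simp add: scalar_prod_def vec_mat_index dim_vec_mat atLeast0LessThan)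

section \<open>The permutation between two vectorized unfoldings\<close>

lemma vec_mat_unfold:
  assumes "1 \<le> n" "n \<le> length ds"
  shows "vec_mat (unfold ds n T) = vec (prod_list ds)
    (\<lambda>k. T (ins_mode n (k mod ds ! (n - 1)) (multi_index (del_mode n ds) (k div ds ! (n - 1)))))"
    (is "_ = ?v")
proof (rule eq_vecI)
  note c = unfold_carrier[of ds n T] and p = prod_list_del_mode[OF assms]
  show "dim_vec (vec_mat (unfold ds n T)) = dim_vec ?v" by (simp add: dim_vec_mat[OF c] p)
  fix k assume "k < dim_vec ?v"
  then have k: "k < ds ! (n - 1) * prod_list (del_mode n ds)" by (simp add: p)
  then have "k mod ds ! (n - 1) < ds ! (n - 1)" "k div ds ! (n - 1) < prod_list (del_mode n ds)"
    by (auto simp: less_mult_imp_div_less mult.commute intro!: mod_less_divisor gr0I)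
  then show "vec_mat (unfold ds n T) $ k = ?v $ k"
    using k by (subst vec_mat_index[OF c k]) (simp add: unfold_def p)
qed

lemma bij_betw_unfold_index:
  assumes "1 \<le> n" "n \<le> length ds"
  shows "bij_betw (\<lambda>k. ins_mode n (k mod ds ! (n - 1)) (multi_index (del_mode n ds) (k div ds ! (n - 1))))
           {..<prod_list ds} {ix. list_all2 (<) ix ds}"
  using bij_betw_trans[OF bij_betw_mod_div bij_betw_ins_mode[OF assms]]
  by (simp add: prod_list_del_mode[OF assms] comp_def)

text \<open>Vectorizing an unfolding lists the entries of the tensor along an enumeration
  \<open>x n\<close> of the multi-indices that depends on the mode alone. Two enumerations of one
  finite set differ by a permutation, and indicator tensors determine every entry of its
  matrix.\<close>

lemma unfold_permutation_ex1:
  assumes n: "1 \<le> n" "n \<le> length ds"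
  shows "\<exists>!P. unfold_permutation ds n P"
proof -
  let ?m = "prod_list ds" and ?K = "length ds"
  define x where "x n k = ins_mode n (k mod ds ! (n - 1)) (multi_index (del_mode n ds) (k div ds ! (n - 1)))" for n k
  have K: "1 \<le> ?K" "?K \<le> length ds" using n by auto
  have bij: "bij_betw (x k) {..<?m} {ix. list_all2 (<) ix ds}" if "1 \<le> k" "k \<le> length ds" for k
    unfolding x_def using bij_betw_unfold_index[OF that] .
  have vm: "vec_mat (unfold ds k T) = vec ?m (\<lambda>j. T (x k j))" if "1 \<le> k" "k \<le> length ds" for k T
    using vec_mat_unfold[OF that] by (simp add: x_def)
  \<comment> \<open>\<open>p\<close> takes the place of a multi-index in the last-mode enumeration
    to its place in the mode-n enumeration; being the identity elsewhere is what
    \<open>permutes\<close> demands.\<close>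
  define p where "p k = (if k < ?m then inv_into {..<?m} (x n) (x ?K k) else k)" for k
  define P :: "real mat" where "P = mat ?m ?m (\<lambda>(i, j). if j = p i then 1 else 0)"
  have "bij_betw (inv_into {..<?m} (x n) \<circ> x ?K) {..<?m} {..<?m}"
    using bij_betw_trans[OF bij[OF K] bij_betw_inv_into[OF bij[OF n]]] .
  then have bp: "bij_betw p {..<?m} {..<?m}"
    by (rule iffD1[OF bij_betw_cong, rotated]) (simp add: p_def)
  then have "p permutes {..<?m}" by (intro bij_imp_permutes) (auto simp: p_def)
  then have perm: "permutation_mat ?m P" unfolding permutation_mat_def P_def by blast
  have xp: "x n (p k) = x ?K k" "p k < ?m" if "k < ?m" for k
  proof -
    show "p k < ?m" using bij_betwE[OF bp] that by auto
    have "x ?K k \<in> x n ` {..<?m}"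
      using bij_betwE[OF bij[OF K]] bij_betw_imp_surj_on[OF bij[OF n]] that by auto
    then show "x n (p k) = x ?K k" using that by (simp add: p_def f_inv_into_f)
  qed
  have "vec_mat (unfold ds ?K T) = P *\<^sub>v vec_mat (unfold ds n T)" for T
  proof (rule eq_vecI)
    fix k assume "k < dim_vec (P *\<^sub>v vec_mat (unfold ds n T))"
    then have k: "k < ?m" by (simp add: P_def)
    have "(P *\<^sub>v vec_mat (unfold ds n T)) $ k = (\<Sum>j<?m. (if j = p k then 1 else 0) * T (x n j))"
      using k by (simp add: P_def vm[OF n] scalar_prod_def atLeast0LessThan)
    also have "\<dots> = (\<Sum>j<?m. if p k = j then T (x n j) else 0)"
      by (intro sum.cong) auto
    also have "\<dots> = T (x ?K k)" using xp[OF k] by (subst sum.delta') auto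
    finally show "vec_mat (unfold ds ?K T) $ k = (P *\<^sub>v vec_mat (unfold ds n T)) $ k"
      using k by (simp add: vm[OF K])
  qed (simp add: vm[OF K] P_def)
  with perm have ex: "unfold_permutation ds n P" by (simp add: unfold_permutation_def)
  have entry: "Q $$ (i, j) = (if x ?K i = x n j then 1 else 0)" "Q \<in> carrier_mat ?m ?m"
    if Q: "unfold_permutation ds n Q" and ij: "i < ?m" "j < ?m" for Q i j
  proof -
    show c: "Q \<in> carrier_mat ?m ?m" using Q by (auto simp: unfold_permutation_def permutation_mat_def)
    \<comment> \<open>The indicator of the j-th multi-index vectorizes in mode n to a unit vector,
      so multiplying by \<open>Q\<close> reads off column j of \<open>Q\<close>.\<close>
    let ?T = "\<lambda>ix. if ix = x n j then 1 else (0 :: real)"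
    have "vec_mat (unfold ds n ?T) = unit_vec ?m j"
      using inj_onD[OF bij_betw_imp_inj_on[OF bij[OF n]]] ij by (auto simp: vm[OF n] unit_vec_def)
    then have "vec_mat (unfold ds ?K ?T) = Q *\<^sub>v unit_vec ?m j" using Q by (simp add: unfold_permutation_def)
    then have "vec_mat (unfold ds ?K ?T) $ i = Q $$ (i, j)"
      using c ij by simp
    then show "Q $$ (i, j) = (if x ?K i = x n j then 1 else 0)" using ij by (simp add: vm[OF K])
  qed
  have "Q = P" if Q: "unfold_permutation ds n Q" for Q
  proof (rule eq_matI)
    have "Q \<in> carrier_mat ?m ?m" using Q by (auto simp: unfold_permutation_def permutation_mat_def)
    then show "dim_row Q = dim_row P" "dim_col Q = dim_col P" by (auto simp: P_def)
    fix i j assume "i < dim_row P" "j < dim_col P"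
    then show "Q $$ (i, j) = P $$ (i, j)" using entry(1)[OF Q] entry(1)[OF ex] by (simp add: P_def)
  qed
  with ex show ?thesis by blast
qed

section \<open>Derivatives along curves of matrices\<close>

lemma frob_norm_le_sum:
  assumes "H \<in> carrier_mat n m"
  shows "frob_norm H \<le> (\<Sum>i<n. \<Sum>j<m. \<bar>H $$ (i, j)\<bar>)"
proof -
  have "frob_norm H = L2_set (\<lambda>(i, j). H $$ (i, j)) ({..<n} \<times> {..<m})"
    using assms by (simp add: frob_norm_def scalar_prod_vec_mat L2_set_def sum.cartesian_product
      case_prod_unfold power2_eq_square)
  also have "\<dots> \<le> (\<Sum>(i, j)\<in>{..<n} \<times> {..<m}. \<bar>H $$ (i, j)\<bar>)"
    using L2_set_le_sum_abs[of "\<lambda>(i, j). H $$ (i, j)"] by (simp add: case_prod_unfold)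
  finally show ?thesis by (simp add: sum.cartesian_product)
qed

text \<open>A local Lipschitz bound at a; the summand 1 is slack that makes the limit argument
  strict. It turns an error small against the Frobenius norm of the increment into one small against
  the increment of t.\<close>

lemma eventually_DERIV_bound:
  fixes f :: "real \<Rightarrow> real"
  assumes "(f has_real_derivative D) (at a)"
  shows "\<forall>\<^sub>F t in at a. \<bar>f t - f a\<bar> \<le> (\<bar>D\<bar> + 1) * \<bar>t - a\<bar>"
proof -
  have "((\<lambda>t. \<bar>(f t - f a) / (t - a)\<bar>) \<longlongrightarrow> \<bar>D\<bar>) (at a)"
    using assms by (intro tendsto_rabs) (simp add: has_field_derivative_iff)
  then have "\<forall>\<^sub>F t in at a. \<bar>(f t - f a) / (t - a)\<bar> < \<bar>D\<bar> + 1"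
    by (rule order_tendstoD) simp
  moreover have "\<forall>\<^sub>F t in at a. t \<noteq> a" by (simp add: eventually_at_filter)
  ultimately show ?thesis
    by eventually_elim (simp add: abs_divide divide_less_eq)
qed

text \<open>The chain rule for a Frechet differentiable function on matrices of fixed size. After
  subtracting the linear part \<open>?lin\<close>, the remainder is small against the Frobenius norm
  of \<open>Y t - Y a\<close>, which is of order \<open>t - a\<close>, so its derivative is
  0.\<close>

lemma has_real_derivative_mat_curve:
  assumes A: "A \<in> carrier_mat n m"
    and diff: "\<forall>e>0. \<exists>d>0. \<forall>H \<in> carrier_mat n m. frob_norm H < d \<longrightarrow>
          \<bar>f (Y a + H) - f (Y a) - vec_mat A \<bullet> vec_mat H\<bar> \<le> e * frob_norm H"
    and Y: "\<And>t. Y t \<in> carrier_mat n m"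
    and Y': "\<And>i j. i < n \<Longrightarrow> j < m \<Longrightarrow> ((\<lambda>t. Y t $$ (i, j)) has_real_derivative Y' i j) (at a)"
  shows "((\<lambda>t. f (Y t)) has_real_derivative (\<Sum>i<n. \<Sum>j<m. A $$ (i, j) * Y' i j)) (at a)"
proof -
  \<comment> \<open>The sum of the local Lipschitz constants of all entries; it bounds the Frobenius
    norm because that norm is at most the sum of absolute values.\<close>
  define C where "C = (\<Sum>i<n. \<Sum>j<m. \<bar>Y' i j\<bar> + 1)"
  have C: "C \<ge> 0" unfolding C_def by (intro sum_nonneg) auto
  let ?lin = "\<lambda>t. \<Sum>i<n. \<Sum>j<m. A $$ (i, j) * Y t $$ (i, j)"
  have "\<forall>\<^sub>F t in at a. \<forall>i\<in>{..<n}. \<forall>j\<in>{..<m}. \<bar>Y t $$ (i, j) - Y a $$ (i, j)\<bar> \<le> (\<bar>Y' i j\<bar> + 1) * \<bar>t - a\<bar>"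
    using eventually_DERIV_bound[OF Y'] by (intro eventually_ball_finite ballI) auto
  then have frob: "\<forall>\<^sub>F t in at a. frob_norm (Y t - Y a) \<le> C * \<bar>t - a\<bar>"
  proof eventually_elim
    case (elim t)
    have "frob_norm (Y t - Y a) \<le> (\<Sum>i<n. \<Sum>j<m. \<bar>(Y t - Y a) $$ (i, j)\<bar>)"
      using Y by (intro frob_norm_le_sum minus_carrier_mat)
    also have "\<dots> \<le> (\<Sum>i<n. \<Sum>j<m. (\<bar>Y' i j\<bar> + 1) * \<bar>t - a\<bar>)"
      using elim carrier_matD[OF Y[of t]] carrier_matD[OF Y[of a]] by (intro sum_mono) simp
    finally show ?case by (simp add: C_def sum_distrib_right)
  qed
  have "((\<lambda>t. f (Y t) - ?lin t) has_real_derivative 0) (at a)"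
    unfolding has_field_derivative_iff tendsto_iff
  proof safe
    fix e :: real assume "e > 0"
    \<comment> \<open>Dividing by \<open>C + 1\<close> instead of \<open>C\<close> covers
      \<open>C = 0\<close> (an empty matrix) and gives the strict inequality
      \<open>e' * C < e\<close>.\<close>
    define e' where "e' = e / (C + 1)"
    have e': "e' > 0" "e' * C < e" using C \<open>e > 0\<close> by (auto simp: e'_def field_simps)
    obtain d where d: "d > 0" and *: "\<And>H. H \<in> carrier_mat n m \<Longrightarrow> frob_norm H < d \<Longrightarrow>
          \<bar>f (Y a + H) - f (Y a) - vec_mat A \<bullet> vec_mat H\<bar> \<le> e' * frob_norm H"
      using diff e' by blast
    have "((\<lambda>t. C * \<bar>t - a\<bar>) \<longlongrightarrow> C * \<bar>a - a\<bar>) (at a)" by (intro tendsto_intros)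
    then have "\<forall>\<^sub>F t in at a. C * \<bar>t - a\<bar> < d" by (rule order_tendstoD) (use d in simp)
    moreover have "\<forall>\<^sub>F t in at a. t \<noteq> a" by (simp add: eventually_at_filter)
    ultimately show "\<forall>\<^sub>F t in at a. dist ((f (Y t) - ?lin t - (f (Y a) - ?lin a)) / (t - a)) 0 < e"
      using frob
    proof eventually_elim
      case (elim t)
      let ?H = "Y t - Y a"
      have H: "?H \<in> carrier_mat n m" using Y by (intro minus_carrier_mat)
      have YH: "Y a + ?H = Y t" using carrier_matD[OF Y[of t]] carrier_matD[OF Y[of a]] by (intro eq_matI) auto
      have "vec_mat A \<bullet> vec_mat ?H = ?lin t - ?lin a"
        using carrier_matD[OF Y[of t]] carrier_matD[OF Y[of a]]
        by (simp add: scalar_prod_vec_mat[OF A H] right_diff_distrib sum_subtractf)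
      then have "\<bar>f (Y t) - ?lin t - (f (Y a) - ?lin a)\<bar> \<le> e' * frob_norm ?H"
        using *[OF H] elim by (simp add: YH algebra_simps)
      also have "\<dots> \<le> e' * (C * \<bar>t - a\<bar>)" using elim e' by (intro mult_left_mono) auto
      also have "\<dots> < e * \<bar>t - a\<bar>" using e' elim by (simp add: mult.assoc[symmetric])
      finally show ?case using elim by (simp add: dist_real_def abs_divide divide_less_eq)
    qed
  qed
  moreover have "(?lin has_real_derivative (\<Sum>i<n. \<Sum>j<m. A $$ (i, j) * Y' i j)) (at a)"
    using Y' by (intro DERIV_sum DERIV_cmult) auto
  ultimately have "((\<lambda>t. (f (Y t) - ?lin t) + ?lin t) has_real_derivative
      0 + (\<Sum>i<n. \<Sum>j<m. A $$ (i, j) * Y' i j)) (at a)"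
    by (rule DERIV_add)
  then show ?thesis by simp
qed

lemma index_update_mat_DERIV:
  assumes "V \<in> carrier_mat n m" "a < n" "c < m"
  shows "((\<lambda>t. (V |\<^sub>m (i, j) \<mapsto> t) $$ (a, c)) has_real_derivative (if a = i \<and> c = j then 1 else 0)) (at x)"
proof (cases "a = i \<and> c = j")
  case True
  then have "(\<lambda>t. (V |\<^sub>m (i, j) \<mapsto> t) $$ (a, c)) = (\<lambda>t. t)" using assms by auto
  then show ?thesis using True by auto
next
  case False
  then have "(\<lambda>t. (V |\<^sub>m (i, j) \<mapsto> t) $$ (a, c)) = (\<lambda>t. V $$ (a, c))" using assms by auto
  then show ?thesis using False by auto
qed

lemma update_mat_same: "V \<in> carrier_mat n m \<Longrightarrow> i < n \<Longrightarrow> j < m \<Longrightarrow> (V |\<^sub>m (i, j) \<mapsto> V $$ (i, j)) = V"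
  by (intro eq_matI) (auto simp: update_mat_def)

lemma update_mat_carrier: "V \<in> carrier_mat n m \<Longrightarrow> (V |\<^sub>m ij \<mapsto> t) \<in> carrier_mat n m"
  by (auto simp: update_mat_def)

text \<open>Differentiability yields some linear functional \<open>A\<close>, whereas the recursion
  for \<open>D\<close> starts from \<open>mat_grad\<close>, made of one-variable derivatives. The
  chain rule applied to coordinate curves identifies the gradient with \<open>A\<close> times the
  derivative of the activation, entry by entry.\<close>

lemma has_real_derivative_loss_activation:
  assumes L: "mat_differentiable L (map_mat \<sigma> (Y a))" and \<sigma>: "\<And>x. \<sigma> differentiable (at x)"
    and Y: "\<And>t. Y t \<in> carrier_mat n m"
    and Y': "\<And>i j. i < n \<Longrightarrow> j < m \<Longrightarrow> ((\<lambda>t. Y t $$ (i, j)) has_real_derivative Y' i j) (at a)"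
  shows "((\<lambda>t. L (map_mat \<sigma> (Y t))) has_real_derivative
    (\<Sum>i<n. \<Sum>j<m. mat_grad (\<lambda>V. L (map_mat \<sigma> V)) (Y a) $$ (i, j) * Y' i j)) (at a)"
proof -
  obtain A where A: "A \<in> carrier_mat n m" and d: "\<forall>e>0. \<exists>d>0. \<forall>H \<in> carrier_mat n m. frob_norm H < d \<longrightarrow>
          \<bar>L (map_mat \<sigma> (Y a) + H) - L (map_mat \<sigma> (Y a)) - vec_mat A \<bullet> vec_mat H\<bar> \<le> e * frob_norm H"
    using L carrier_matD[OF Y[of a]] unfolding mat_differentiable_def by auto
  have \<sigma>': "(\<sigma> has_real_derivative deriv \<sigma> x) (at x)" for x
    using \<sigma> by (simp add: DERIV_deriv_iff_real_differentiable)
  \<comment> \<open>Stated for every curve through \<open>Y a\<close>: it serves for the given curve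
    and for the coordinate curves that compute \<open>mat_grad\<close>.\<close>
  have curve: "((\<lambda>t. L (map_mat \<sigma> (X t))) has_real_derivative
    (\<Sum>i<n. \<Sum>j<m. A $$ (i, j) * (deriv \<sigma> (Y a $$ (i, j)) * X' i j))) (at x)"
    if X: "\<And>t. X t \<in> carrier_mat n m" and Xx: "X x = Y a"
      and X': "\<And>i j. i < n \<Longrightarrow> j < m \<Longrightarrow> ((\<lambda>t. X t $$ (i, j)) has_real_derivative X' i j) (at x)"
    for X X' and x :: real
  proof (rule has_real_derivative_mat_curve[OF A])
    show "map_mat \<sigma> (X t) \<in> carrier_mat n m" for t using X by simp
    show "\<forall>e>0. \<exists>d>0. \<forall>H \<in> carrier_mat n m. frob_norm H < d \<longrightarrow>
          \<bar>L (map_mat \<sigma> (X x) + H) - L (map_mat \<sigma> (X x)) - vec_mat A \<bullet> vec_mat H\<bar> \<le> e * frob_norm H"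
      using d by (simp add: Xx)
    fix i j assume ij: "i < n" "j < m"
    have "((\<lambda>t. \<sigma> (X t $$ (i, j))) has_real_derivative deriv \<sigma> (Y a $$ (i, j)) * X' i j) (at x)"
      using DERIV_chain2[OF \<sigma>' X'[OF ij]] by (simp add: Xx)
    then show "((\<lambda>t. map_mat \<sigma> (X t) $$ (i, j)) has_real_derivative deriv \<sigma> (Y a $$ (i, j)) * X' i j) (at x)"
      using ij carrier_matD[OF X] by simp
  qed
  have grad: "mat_grad (\<lambda>V. L (map_mat \<sigma> V)) (Y a) $$ (i, j) = A $$ (i, j) * deriv \<sigma> (Y a $$ (i, j))"
    if ij: "i < n" "j < m" for i j
  proof -
    have "((\<lambda>t. L (map_mat \<sigma> (Y a |\<^sub>m (i, j) \<mapsto> t))) has_real_derivative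
        (\<Sum>k<n. \<Sum>c<m. A $$ (k, c) * (deriv \<sigma> (Y a $$ (k, c)) * (if k = i \<and> c = j then 1 else 0))))
        (at (Y a $$ (i, j)))"
      using ij by (intro curve update_mat_carrier update_mat_same index_update_mat_DERIV) (use Y in auto)
    also have "(\<Sum>k<n. \<Sum>c<m. A $$ (k, c) * (deriv \<sigma> (Y a $$ (k, c)) * (if k = i \<and> c = j then 1 else 0))) =
        A $$ (i, j) * deriv \<sigma> (Y a $$ (i, j))"
      using sum_sum_delta[OF ij, of "\<lambda>k c. A $$ (k, c) * deriv \<sigma> (Y a $$ (k, c))"] by (simp add: mult.assoc)
    finally show ?thesis using ij carrier_matD[OF Y[of a]] by (simp add: mat_grad_def DERIV_imp_deriv)
  qed
  have "(\<Sum>i<n. \<Sum>j<m. mat_grad (\<lambda>V. L (map_mat \<sigma> V)) (Y a) $$ (i, j) * Y' i j) =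
     (\<Sum>i<n. \<Sum>j<m. A $$ (i, j) * (deriv \<sigma> (Y a $$ (i, j)) * Y' i j))"
    by (intro sum.cong refl) (simp add: grad)
  then show ?thesis using curve[OF Y refl Y'] by simp
qed

section \<open>Backpropagation\<close>

lemma pre_activation_carrier:
  "A \<in> carrier_mat n p \<Longrightarrow> c \<in> carrier_vec n \<Longrightarrow> Z \<in> carrier_mat p m \<Longrightarrow> pre_activation A c Z \<in> carrier_mat n m"
  by (auto simp: pre_activation_def ones_row_def)

lemma pre_activation_index:
  assumes "A \<in> carrier_mat n p" "c \<in> carrier_vec n" "Z \<in> carrier_mat p m" "i < n" "j < m"
  shows "pre_activation A c Z $$ (i, j) = (\<Sum>q<p. A $$ (i, q) * Z $$ (q, j)) + c $ i"
  using assms by (auto simp: pre_activation_def ones_row_def scalar_prod_def atLeast0LessThan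
    mat_of_cols_index One_nat_def)

text \<open>The induction descends from the output layer with the tangent \<open>F'\<close> left
  arbitrary, since each step replaces \<open>F'\<close> by its image under the linearized next
  layer. Above layer l the weights \<open>A\<close> and biases \<open>c\<close> do not move with t,
  so this image is linear in \<open>F'\<close>.\<close>

lemma has_real_derivative_backpropagation:
  fixes F :: "nat \<Rightarrow> real \<Rightarrow> real mat"
  assumes "l \<le> K" and \<sigma>: "\<And>x. \<sigma> differentiable (at x)"
    and L: "\<And>Y. Y \<in> carrier_mat (d K) m \<Longrightarrow> mat_differentiable L Y"
    and F: "\<And>k t. l \<le> k \<Longrightarrow> k \<le> K \<Longrightarrow> F k t \<in> carrier_mat (d k) m"
    and F_Suc: "\<And>k t. l \<le> k \<Longrightarrow> k < K \<Longrightarrow>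
      F (Suc k) t = pre_activation (A (Suc k)) (c (Suc k)) (map_mat \<sigma> (F k t))"
    and A: "\<And>k. l \<le> k \<Longrightarrow> k < K \<Longrightarrow> A (Suc k) \<in> carrier_mat (d (Suc k)) (d k)"
    and c: "\<And>k. l \<le> k \<Longrightarrow> k < K \<Longrightarrow> c (Suc k) \<in> carrier_vec (d (Suc k))"
    and D: "\<And>k. l \<le> k \<Longrightarrow> k \<le> K \<Longrightarrow> D k \<in> carrier_mat (d k) m"
    and D_last: "D K = mat_grad (\<lambda>Y. L (map_mat \<sigma> Y)) (F K a)"
    and D_step: "\<And>k. l \<le> k \<Longrightarrow> k < K \<Longrightarrow>
      D k = hadamard ((A (Suc k))\<^sup>T * D (Suc k)) (map_mat (deriv \<sigma>) (F k a))"
    and F': "\<And>i j. i < d l \<Longrightarrow> j < m \<Longrightarrow> ((\<lambda>t. F l t $$ (i, j)) has_real_derivative F' i j) (at a)"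
  shows "((\<lambda>t. L (map_mat \<sigma> (F K t))) has_real_derivative (\<Sum>i<d l. \<Sum>j<m. D l $$ (i, j) * F' i j)) (at a)"
  using assms(1,4-11)
proof (induction l arbitrary: F' rule: inc_induct)
  case base
  show ?case unfolding base.prems(6)
    by (rule has_real_derivative_loss_activation) (use base.prems \<sigma> L in auto)
next
  case (step k)
  note prems = step.prems
  have Fk: "F k t \<in> carrier_mat (d k) m" for t using prems(1) step.hyps by simp
  have Ak: "A (Suc k) \<in> carrier_mat (d (Suc k)) (d k)" using prems(3) step.hyps by simp
  have ck: "c (Suc k) \<in> carrier_vec (d (Suc k))" using prems(4) step.hyps by simp
  have Dk: "D (Suc k) \<in> carrier_mat (d (Suc k)) m" using prems(5) step.hyps by simp
  let ?s = "\<lambda>q j. deriv \<sigma> (F k a $$ (q, j))"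
  have \<sigma>': "(\<sigma> has_real_derivative deriv \<sigma> x) (at x)" for x
    using \<sigma> by (simp add: DERIV_deriv_iff_real_differentiable)
  have "((\<lambda>t. L (map_mat \<sigma> (F K t))) has_real_derivative
    (\<Sum>i<d (Suc k). \<Sum>j<m. D (Suc k) $$ (i, j) * (\<Sum>q<d k. A (Suc k) $$ (i, q) * (?s q j * F' q j)))) (at a)"
  proof (rule step.IH)
    fix i j assume ij: "i < d (Suc k)" "j < m"
    have "F (Suc k) t $$ (i, j) = (\<Sum>q<d k. A (Suc k) $$ (i, q) * \<sigma> (F k t $$ (q, j))) + c (Suc k) $ i" for t
      using pre_activation_index[OF Ak ck map_carrier_mat[THEN iffD2, OF Fk] ij] carrier_matD[OF Fk[of t]] ij
        prems(2)[of k t] step.hyps by simp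
    moreover have "((\<lambda>t. (\<Sum>q<d k. A (Suc k) $$ (i, q) * \<sigma> (F k t $$ (q, j))) + c (Suc k) $ i) has_real_derivative
       (\<Sum>q<d k. A (Suc k) $$ (i, q) * (?s q j * F' q j)) + 0) (at a)"
      using ij by (intro DERIV_add DERIV_sum DERIV_cmult DERIV_const DERIV_chain2[OF \<sigma>' prems(8)]) auto
    ultimately show "((\<lambda>t. F (Suc k) t $$ (i, j)) has_real_derivative
       (\<Sum>q<d k. A (Suc k) $$ (i, q) * (?s q j * F' q j))) (at a)" by simp
  qed (use prems step.hyps in auto)
  \<comment> \<open>Summing over i innermost moves the weights from the tangent to
    \<open>D (Suc k)\<close>, which produces their transpose; the activation derivative is then the
    Hadamard factor of \<open>D k\<close>.\<close>
  also have "(\<Sum>i<d (Suc k). \<Sum>j<m. D (Suc k) $$ (i, j) * (\<Sum>q<d k. A (Suc k) $$ (i, q) * (?s q j * F' q j)))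
     = (\<Sum>q<d k. \<Sum>j<m. \<Sum>i<d (Suc k). A (Suc k) $$ (i, q) * D (Suc k) $$ (i, j) * (?s q j * F' q j))"
    unfolding sum_distrib_left
    by (subst (2) sum.swap, subst sum.swap, subst (2) sum.swap) (simp add: mult_ac)
  also have "\<dots> = (\<Sum>q<d k. \<Sum>j<m. D k $$ (q, j) * F' q j)"
  proof (intro sum.cong refl)
    fix q j assume "q \<in> {..<d k}" "j \<in> {..<m}"
    then have "D k $$ (q, j) = (\<Sum>i<d (Suc k). A (Suc k) $$ (i, q) * D (Suc k) $$ (i, j)) * ?s q j"
      using carrier_matD[OF Ak] carrier_matD[OF Dk] carrier_matD[OF Fk[of a]] prems(7)[of k] step.hyps
      by (simp add: hadamard_def scalar_prod_def atLeast0LessThan)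
    then show "(\<Sum>i<d (Suc k). A (Suc k) $$ (i, q) * D (Suc k) $$ (i, j) * (?s q j * F' q j)) = D k $$ (q, j) * F' q j"
      by (simp add: sum_distrib_left mult_ac)
  qed
  finally show ?case .
qed

section \<open>Derivatives of the unfoldings\<close>

lemma unfold_refold:
  assumes "1 \<le> n" "n \<le> length ds" "V \<in> carrier_mat (ds ! (n - 1)) (prod_list (del_mode n ds))"
  shows "unfold ds n (refold ds n V) = V"
proof (rule eq_matI)
  fix i j assume "i < dim_row V" "j < dim_col V"
  then have ij: "i < ds ! (n - 1)" "j < prod_list (del_mode n ds)" using assms(3) by auto
  have "n - 1 \<le> length (multi_index (del_mode n ds) j)"
    using assms by (simp add: multi_index_def length_del_mode)
  then show "unfold ds n (refold ds n V) $$ (i, j) = V $$ (i, j)"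
    using ij assms by (simp add: unfold_def refold_def nth_ins_mode_same del_ins_mode lin_index_multi_index)
qed (use assms in \<open>auto simp: unfold_def\<close>)

lemma has_real_derivative_unfold:
  assumes "1 \<le> n" "n \<le> length ds" "i < ds ! (n - 1)" "j < prod_list (del_mode n ds)"
    and "\<And>ix. list_all2 (<) ix ds \<Longrightarrow> ((\<lambda>t. T t ix) has_real_derivative T' ix) (at a)"
  shows "((\<lambda>t. unfold ds n (T t) $$ (i, j)) has_real_derivative unfold ds n T' $$ (i, j)) (at a)"
  using assms by (auto simp: unfold_def intro!: list_all2_ins_mode multi_index_valid)

text \<open>Every entry of a tensor is an entry of each of its unfoldings. A derivative known in
  mode n is thus a derivative of the tensor, with value \<open>refold ds n E\<close>, and can be
  read in mode m.\<close>

lemma has_real_derivative_unfold_change_mode: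
  assumes n: "1 \<le> n" "n \<le> length ds" and m: "1 \<le> m" "m \<le> length ds"
    and E: "E \<in> carrier_mat (ds ! (n - 1)) (prod_list (del_mode n ds))"
    and d: "\<And>i j. i < ds ! (n - 1) \<Longrightarrow> j < prod_list (del_mode n ds) \<Longrightarrow>
      ((\<lambda>t. unfold ds n (T t) $$ (i, j)) has_real_derivative E $$ (i, j)) (at a)"
    and ij: "i < ds ! (m - 1)" "j < prod_list (del_mode m ds)"
  shows "((\<lambda>t. unfold ds m (T t) $$ (i, j)) has_real_derivative unfold ds m (refold ds n E) $$ (i, j)) (at a)"
proof (rule has_real_derivative_unfold[OF m ij])
  fix ix assume ix: "list_all2 (<) ix ds"
  have "ix ! (n - 1) < ds ! (n - 1)"
    using ix n by (auto simp: list_all2_conv_all_nth)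
  then show "((\<lambda>t. T t ix) has_real_derivative refold ds n E ix) (at a)"
    using d[OF _ lin_index_less[OF list_all2_del_mode[OF ix]]]
    unfolding refold_def unfold_entry[OF ix n, symmetric] by blast
qed

text \<open>The derivative is the matrix unit at (i, j) times \<open>K\<close>: row j of
  \<open>K\<close> placed in row i.\<close>

lemma has_real_derivative_update_mult:
  assumes V: "V \<in> carrier_mat n r" and K: "K \<in> carrier_mat r m"
    and "i < n" "j < r" "a < n" "c < m"
  shows "((\<lambda>t. ((V |\<^sub>m (i, j) \<mapsto> t) * K) $$ (a, c)) has_real_derivative (if a = i then K $$ (j, c) else 0)) (at x)"
proof -
  have "((V |\<^sub>m (i, j) \<mapsto> t) * K) $$ (a, c) = (\<Sum>k<r. (V |\<^sub>m (i, j) \<mapsto> t) $$ (a, k) * K $$ (k, c))" for t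
    using assms carrier_matD[OF update_mat_carrier[OF V]] by (auto simp: scalar_prod_def atLeast0LessThan)
  moreover have "((\<lambda>t. \<Sum>k<r. (V |\<^sub>m (i, j) \<mapsto> t) $$ (a, k) * K $$ (k, c)) has_real_derivative
      (\<Sum>k<r. (if a = i \<and> k = j then 1 else 0) * K $$ (k, c))) (at x)"
    using assms by (intro DERIV_sum DERIV_cmult_right index_update_mat_DERIV[OF V]) auto
  moreover have "(\<Sum>k<r. (if a = i \<and> k = j then 1 else 0) * K $$ (k, c)) =
      (\<Sum>k<r. if k = j then (if a = i then K $$ (k, c) else 0) else 0)"
    by (intro sum.cong) auto
  ultimately show ?thesis using assms by (simp add: sum.delta)
qed

text \<open>The column-stacking identity vec(X K) = (K^T \<otimes> I) vec(X), read as a Jacobian.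
  \<open>Y\<close> is compared with right multiplication only on matrices of the proper size, the
  setting in which a Tucker unfolding has this form.\<close>

lemma mat_jacobian_mult_right:
  assumes V: "V \<in> carrier_mat n r" and K: "K \<in> carrier_mat r m"
    and Y: "\<And>X. X \<in> carrier_mat n r \<Longrightarrow> Y X = X * K"
  shows "mat_jacobian_exists Y V" "mat_jacobian Y V = kron K\<^sup>T (1\<^sub>m n)"
proof -
  have YX: "Y X \<in> carrier_mat n m" if "X \<in> carrier_mat n r" for X using Y[OF that] that K by simp
  have DERIV: "((\<lambda>t. vec_mat (Y (V |\<^sub>m (i, j) \<mapsto> t)) $ p) has_real_derivative
      (if p mod n = i then K $$ (j, p div n) else 0)) (at x)"
    if "p < n * m" "i < n" "j < r" for p i j x
  proof -
    have "p mod n < n" "p div n < m"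
      using that by (auto simp: less_mult_imp_div_less mult.commute intro!: mod_less_divisor gr0I)
    moreover have "vec_mat (Y (V |\<^sub>m (i, j) \<mapsto> t)) $ p = ((V |\<^sub>m (i, j) \<mapsto> t) * K) $$ (p mod n, p div n)" for t
      using vec_mat_index[OF YX[OF update_mat_carrier[OF V]] that(1)] Y[OF update_mat_carrier[OF V]] by simp
    ultimately show ?thesis
      using has_real_derivative_update_mult[OF V K that(2,3)] by presburger
  qed
  then show "mat_jacobian_exists Y V"
    using V unfolding mat_jacobian_exists_def mat_partials_exist_def real_differentiable_def
    by (auto simp: dim_vec_mat[OF YX[OF V]] intro!: exI DERIV)
  show "mat_jacobian Y V = kron K\<^sup>T (1\<^sub>m n)"
  proof (rule eq_matI)
    fix p q assume "p < dim_row (kron K\<^sup>T (1\<^sub>m n))" "q < dim_col (kron K\<^sup>T (1\<^sub>m n))"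
    then have p: "p < n * m" and q: "q < n * r" using K by (auto simp: kron_def mult.commute)
    have lt: "p mod n < n" "p div n < m" "q mod n < n" "q div n < r"
      using p q by (auto simp: less_mult_imp_div_less mult.commute intro!: mod_less_divisor gr0I)
    have g: "mat_grad f V \<in> carrier_mat n r" for f using V by (simp add: mat_grad_def)
    have "mat_jacobian Y V $$ (p, q) = mat_grad (\<lambda>X. vec_mat (Y X) $ p) V $$ (q mod n, q div n)"
      using p q by (simp add: mat_jacobian_def dim_vec_mat[OF YX[OF V]] dim_vec_mat[OF V] vec_mat_index[OF g])
    also have "\<dots> = (if p mod n = q mod n then K $$ (q div n, p div n) else 0)"
      using DERIV_imp_deriv[OF DERIV[OF p lt(3,4)]] lt V by (simp add: mat_grad_def)
    also have "\<dots> = kron K\<^sup>T (1\<^sub>m n) $$ (p, q)"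
      using K p q lt by (simp add: kron_def mult.commute)
    finally show "mat_jacobian Y V $$ (p, q) = kron K\<^sup>T (1\<^sub>m n) $$ (p, q)" .
  qed (use V K in \<open>auto simp: mat_jacobian_def dim_vec_mat[OF YX[OF V]] dim_vec_mat[OF V] kron_def\<close>)
qed

lemma index_mult_transpose:
  assumes "A \<in> carrier_mat n p" "B \<in> carrier_mat m p" "i < n" "j < m"
  shows "(A * B\<^sup>T) $$ (i, j) = (\<Sum>c<p. A $$ (i, c) * B $$ (j, c))"
  using assms by (simp add: scalar_prod_def atLeast0LessThan)

lemma index_transpose_mult_mult:
  fixes A B C :: "'a::comm_semiring_0 mat"
  assumes "A \<in> carrier_mat n r" "B \<in> carrier_mat n p" "C \<in> carrier_mat p m" "i < r" "j < m"
  shows "(A\<^sup>T * (B * C)) $$ (i, j) = (\<Sum>a<n. \<Sum>c<p. B $$ (a, c) * (A $$ (a, i) * C $$ (c, j)))"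
  using assms by (simp add: scalar_prod_def atLeast0LessThan sum_distrib_left mult_ac)

text \<open>Column q of the Jacobian is the vectorized derivative in coordinate (q mod n, q div n);
  this links the Kronecker formula to derivatives along coordinate curves.\<close>

lemma col_kron_one:
  assumes K: "K \<in> carrier_mat r m" and q: "q < n * r"
  shows "col (kron K\<^sup>T (1\<^sub>m n)) q = vec_mat (mat n m (\<lambda>(a, c). if a = q mod n then K $$ (q div n, c) else 0))"
proof (rule eq_vecI)
  let ?E = "mat n m (\<lambda>(a, c). if a = q mod n then K $$ (q div n, c) else 0)"
  have E: "?E \<in> carrier_mat n m" by simp
  fix p assume "p < dim_vec (vec_mat ?E)"
  then have p: "p < n * m" by (simp add: dim_vec_mat[OF E])
  have lt: "p mod n < n" "p div n < m" "q mod n < n" "q div n < r"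
    using p q by (auto simp: less_mult_imp_div_less mult.commute intro!: mod_less_divisor gr0I)
  show "col (kron K\<^sup>T (1\<^sub>m n)) q $ p = vec_mat ?E $ p"
    using lt p q K by (simp add: vec_mat_index[OF E] kron_def mult.commute)
qed (use K in \<open>simp add: vec_mat_def kron_def mult.commute\<close>)

section \<open>The network\<close>

lemma prod_list_dims: "prod_list (dims k d) = (\<Prod>n = 1..k. d n)"
proof -
  have "prod_list (dims k d) = prod d (set [1..<Suc k])"
    unfolding dims_def by (intro prod.distinct_set_conv_list[symmetric] distinct_upt)
  then show ?thesis by (simp only: set_upt atLeastLessThanSuc_atLeastAtMost)
qed

lemma del_mode_dims_last: "del_mode (k + 1) (dims (k + 1) d) = dims k d"
  by (simp add: del_mode_def dims_Suc flip: Suc_eq_plus1)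

lemma nth_dims_last: "dims (k + 1) d ! (k + 1 - 1) = d (k + 1)"
  by (simp add: nth_dims flip: Suc_eq_plus1)

lemma weight_mat_carrier: "weight_mat N I G U l \<in> carrier_mat (I l (N + 1)) (prod_list (dims N (I l)))"
  using unfold_carrier[of "dims (N + 1) (I l)" "N + 1"]
  unfolding weight_mat_def del_mode_dims_last nth_dims_last .

text \<open>Core and factors act only through the weight matrix. Hence layers below the perturbed
  one stay constant, and equal weights suffice to recover the original network at the base
  point.\<close>

lemma layer_out_cong:
  assumes "\<And>k. 1 \<le> k \<Longrightarrow> k \<le> n \<Longrightarrow> weight_mat N I G U k = weight_mat N I G' U' k"
    and "\<And>k. 1 \<le> k \<Longrightarrow> k \<le> n \<Longrightarrow> b k = b' k"
  shows "layer_out N I \<sigma> Z0 G U b n = layer_out N I \<sigma> Z0 G' U' b' n"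
  using assms by (induction n) auto

lemma kron_rev_cong: "(\<And>n. n \<in> set ns \<Longrightarrow> U n = U' n) \<Longrightarrow> kron_rev U ns = kron_rev U' ns"
  unfolding kron_rev_def by (intro arg_cong2[where f = "\<lambda>xs y. foldr kron xs y"] map_cong) auto

locale tucker_network =
  fixes N M \<Lambda> :: nat
    and I R :: "nat \<Rightarrow> nat \<Rightarrow> nat"
    and G :: "nat \<Rightarrow> tensor"
    and U :: "nat \<Rightarrow> nat \<Rightarrow> real mat"
    and b :: "nat \<Rightarrow> real vec"
    and \<sigma> :: "real \<Rightarrow> real"
    and L :: "real mat \<Rightarrow> real"
    and Z F D :: "nat \<Rightarrow> real mat"
    and Z0 :: "real mat"
  assumes width: "\<And>l. l \<in> {2..\<Lambda>} \<Longrightarrow> prod_list (dims N (I l)) = I (l - 1) (N + 1)"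
    and U: "\<And>l n. l \<in> {1..\<Lambda>} \<Longrightarrow> n \<in> {1..N + 1} \<Longrightarrow> U l n \<in> carrier_mat (I l n) (R l n)"
    and b: "\<And>l. l \<in> {1..\<Lambda>} \<Longrightarrow> b l \<in> carrier_vec (I l (N + 1))"
    and Z0: "Z0 \<in> carrier_mat (prod_list (dims N (I 1))) M"
    and \<sigma>: "\<And>x. \<sigma> differentiable (at x)"
    and Z: "Z = layer_out N I \<sigma> Z0 G U b"
    and F: "\<And>l. l \<in> {1..\<Lambda>} \<Longrightarrow> F l = pre_activation (weight_mat N I G U l) (b l) (Z (l - 1))"
    and L: "\<And>Y. Y \<in> carrier_mat (I \<Lambda> (N + 1)) M \<Longrightarrow> mat_differentiable L Y"
    and D_last: "D \<Lambda> = mat_grad (\<lambda>Y. L (map_mat \<sigma> Y)) (F \<Lambda>)"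
    and D_step: "\<And>l. l \<in> {1..<\<Lambda>} \<Longrightarrow>
           D l = hadamard ((weight_mat N I G U (l + 1))\<^sup>T * D (l + 1)) (map_mat (deriv \<sigma>) (F l))"
begin

text \<open>\<open>unfold\<close> takes the size of the weights from \<open>I\<close>, whatever the
  parameters are, so perturbed networks are covered with arbitrary \<open>G'\<close> and
  \<open>U'\<close>. The size is given as the input size of the next layer, hence the strict bound
  on k.\<close>

lemma layer_out_carrier:
  assumes b': "\<And>k. k \<in> {1..\<Lambda>} \<Longrightarrow> b' k \<in> carrier_vec (I k (N + 1))" and "k < \<Lambda>"
  shows "layer_out N I \<sigma> Z0 G' U' b' k \<in> carrier_mat (prod_list (dims N (I (Suc k)))) M"
  using \<open>k < \<Lambda>\<close>
proof (induction k)
  case 0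
  then show ?case using Z0 by (simp add: One_nat_def)
next
  case (Suc k)
  then have "pre_activation (weight_mat N I G' U' (Suc k)) (b' (Suc k)) (layer_out N I \<sigma> Z0 G' U' b' k) \<in>
      carrier_mat (I (Suc k) (N + 1)) M"
    using b'[of "Suc k"] by (intro pre_activation_carrier[OF weight_mat_carrier]) auto
  then show ?case using width[of "Suc (Suc k)"] Suc.prems by simp
qed

lemma Z_carrier: "l \<in> {1..\<Lambda>} \<Longrightarrow> Z (l - 1) \<in> carrier_mat (prod_list (dims N (I l))) M"
  using layer_out_carrier[of b "l - 1" G U, OF b] unfolding Z by fastforce

lemma F_carrier: "l \<in> {1..\<Lambda>} \<Longrightarrow> F l \<in> carrier_mat (I l (N + 1)) M"
  unfolding F by (intro pre_activation_carrier[OF weight_mat_carrier b Z_carrier])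

lemma D_carrier: "l \<in> {1..\<Lambda>} \<Longrightarrow> D l \<in> carrier_mat (I l (N + 1)) M"
proof -
  have "1 \<le> l \<Longrightarrow> l \<le> \<Lambda> \<Longrightarrow> D l \<in> carrier_mat (I l (N + 1)) M"
  proof (rotate_tac, induction l rule: inc_induct)
    case base
    then show ?case using F_carrier[of \<Lambda>] by (simp add: D_last mat_grad_def)
  next
    case (step l)
    then show ?case
      using D_step[of l] carrier_matD[OF weight_mat_carrier[of N I G U "l + 1"]] width[of "l + 1"]
      by (auto simp: hadamard_def simp flip: Suc_eq_plus1)
  qed
  then show "l \<in> {1..\<Lambda>} \<Longrightarrow> D l \<in> carrier_mat (I l (N + 1)) M" by simp
qed

text \<open>One statement for all kinds of parameters: a factor or core curve has
  \<open>b' = 0\<close>, a bias curve has \<open>W' = 0\<close>. The tangent of the pre-activation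
  is \<open>W'\<close> times the constant input plus \<open>b'\<close> in every column, so pairing
  with \<open>D l\<close> gives \<open>D l * (Z (l - 1))\<^sup>T\<close> against \<open>W'\<close>
  and the row sums of \<open>D l\<close> against \<open>b'\<close>.\<close>

lemma has_real_derivative_loss:
  fixes Gt :: "real \<Rightarrow> nat \<Rightarrow> tensor"
  assumes l: "l \<in> {1..\<Lambda>}"
    and w: "\<And>t k. k \<noteq> l \<Longrightarrow> weight_mat N I (Gt t) (Ut t) k = weight_mat N I G U k"
    and w_a: "weight_mat N I (Gt a) (Ut a) l = weight_mat N I G U l"
    and bk: "\<And>t k. k \<noteq> l \<Longrightarrow> bt t k = b k"
    and b_a: "bt a l = b l"
    and bl: "\<And>t. bt t l \<in> carrier_vec (I l (N + 1))"
    and w': "\<And>i q. i < I l (N + 1) \<Longrightarrow> q < prod_list (dims N (I l)) \<Longrightarrow>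
      ((\<lambda>t. weight_mat N I (Gt t) (Ut t) l $$ (i, q)) has_real_derivative W' i q) (at a)"
    and b': "\<And>i. i < I l (N + 1) \<Longrightarrow> ((\<lambda>t. bt t l $ i) has_real_derivative b' i) (at a)"
  shows "((\<lambda>t. L (layer_out N I \<sigma> Z0 (Gt t) (Ut t) (bt t) \<Lambda>)) has_real_derivative
    (\<Sum>i<I l (N + 1). \<Sum>q<prod_list (dims N (I l)). (D l * (Z (l - 1))\<^sup>T) $$ (i, q) * W' i q)
    + (\<Sum>i<I l (N + 1). (\<Sum>m<M. D l $$ (i, m)) * b' i)) (at a)"
proof -
  let ?p = "prod_list (dims N (I l))" and ?o = "\<lambda>t. layer_out N I \<sigma> Z0 (Gt t) (Ut t) (bt t)"
  let ?n = "I l (N + 1)"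
  define Ft where "Ft k t = pre_activation (weight_mat N I (Gt t) (Ut t) k) (bt t k) (?o t (k - 1))" for k t
  have bt: "bt t k \<in> carrier_vec (I k (N + 1))" if "k \<in> {1..\<Lambda>}" for t k
    using bk[of k t] bl[of t] b[OF that] by (cases "k = l") auto
  have out: "?o t k = map_mat \<sigma> (Ft k t)" if "1 \<le> k" for k t
    using that by (cases k) (auto simp: Ft_def)
  have o_a: "?o a k = Z k" for k
    unfolding Z using w w_a bk b_a by (intro layer_out_cong) metis+
  \<comment> \<open>No moving parameter occurs below layer l, so its input is constant in t and its
    pre-activation is affine in the weights and the bias.\<close>
  have o_l: "?o t (l - 1) = Z (l - 1)" for t
    unfolding Z using w bk l by (intro layer_out_cong) auto
  have F_a: "Ft k a = F k" if "k \<in> {1..\<Lambda>}" for k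
    using that w[of k a] w_a bk[of k a] b_a by (cases "k = l") (simp_all add: Ft_def F o_a)
  have Ft_carrier: "Ft k t \<in> carrier_mat (I k (N + 1)) M" if "k \<in> {1..\<Lambda>}" for k t
    unfolding Ft_def using layer_out_carrier[of "bt t" "k - 1" "Gt t" "Ut t"] bt that
    by (intro pre_activation_carrier[OF weight_mat_carrier]) auto
  have Zl: "Z (l - 1) \<in> carrier_mat ?p M" and Dl: "D l \<in> carrier_mat ?n M"
    using Z_carrier D_carrier l by auto
  let ?F' = "\<lambda>i j. (\<Sum>q<?p. W' i q * Z (l - 1) $$ (q, j)) + b' i"
  have "((\<lambda>t. L (map_mat \<sigma> (Ft \<Lambda> t))) has_real_derivative (\<Sum>i<?n. \<Sum>j<M. D l $$ (i, j) * ?F' i j)) (at a)"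
  proof (rule has_real_derivative_backpropagation[where A = "weight_mat N I G U" and c = b and d = "\<lambda>k. I k (N + 1)"])
    fix k assume k: "l \<le> k" "k < \<Lambda>"
    show "Ft (Suc k) t = pre_activation (weight_mat N I G U (Suc k)) (b (Suc k)) (map_mat \<sigma> (Ft k t))" for t
      using k l w[of "Suc k" t] bk[of "Suc k" t] by (simp add: Ft_def[of "Suc k"] out)
    show "weight_mat N I G U (Suc k) \<in> carrier_mat (I (Suc k) (N + 1)) (I k (N + 1))"
      using weight_mat_carrier[of N I G U "Suc k"] width[of "Suc k"] k l by simp
    show "D k = hadamard ((weight_mat N I G U (Suc k))\<^sup>T * D (Suc k)) (map_mat (deriv \<sigma>) (Ft k a))"
      using D_step[of k] k l by (simp add: F_a flip: Suc_eq_plus1)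
    show "b (Suc k) \<in> carrier_vec (I (Suc k) (N + 1))"
      using b[of "Suc k"] k l by simp
  next
    fix i j assume ij: "i < ?n" "j < M"
    have "Ft l t $$ (i, j) = (\<Sum>q<?p. weight_mat N I (Gt t) (Ut t) l $$ (i, q) * Z (l - 1) $$ (q, j)) + bt t l $ i" for t
      unfolding Ft_def o_l by (rule pre_activation_index[OF weight_mat_carrier[of N I _ _ l] bl Zl ij])
    then show "((\<lambda>t. Ft l t $$ (i, j)) has_real_derivative ?F' i j) (at a)"
      using ij by (auto intro!: DERIV_add DERIV_sum DERIV_cmult_right w' b')
  qed (use l \<sigma> L Ft_carrier D_carrier D_last in \<open>auto simp: F_a\<close>)
  also have "(\<Sum>i<?n. \<Sum>j<M. D l $$ (i, j) * ?F' i j) =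
      (\<Sum>i<?n. (\<Sum>q<?p. (D l * (Z (l - 1))\<^sup>T) $$ (i, q) * W' i q) + (\<Sum>m<M. D l $$ (i, m)) * b' i)"
  proof (intro sum.cong refl)
    fix i assume i: "i \<in> {..<?n}"
    have "(\<Sum>q<?p. (D l * (Z (l - 1))\<^sup>T) $$ (i, q) * W' i q) =
        (\<Sum>q<?p. \<Sum>j<M. D l $$ (i, j) * (W' i q * Z (l - 1) $$ (q, j)))"
      using i carrier_matD[OF Zl] carrier_matD[OF Dl]
      by (intro sum.cong refl) (simp add: scalar_prod_def atLeast0LessThan sum_distrib_left mult_ac)
    also have "\<dots> = (\<Sum>j<M. D l $$ (i, j) * (\<Sum>q<?p. W' i q * Z (l - 1) $$ (q, j)))"
      by (subst sum.swap) (simp add: sum_distrib_left)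
    finally show "(\<Sum>j<M. D l $$ (i, j) * ?F' i j) =
      (\<Sum>q<?p. (D l * (Z (l - 1))\<^sup>T) $$ (i, q) * W' i q) + (\<Sum>m<M. D l $$ (i, m)) * b' i"
      by (simp add: distrib_left sum.distrib sum_distrib_right)
  qed
  also have "(\<lambda>t. L (map_mat \<sigma> (Ft \<Lambda> t))) = (\<lambda>t. L (?o t \<Lambda>))"
    using l by (simp add: out)
  finally show ?thesis by (simp add: sum.distrib)
qed

section \<open>Gradients of the factor matrices\<close>

definition cofactor :: "nat \<Rightarrow> nat \<Rightarrow> real mat" where
  "cofactor l n = unfold (dims (N + 1) (R l)) n (G l) * (kron_rev (U l) (removeAll n [1..<N + 2]))\<^sup>T"

lemma nth_dims_pred: "n \<in> {1..k} \<Longrightarrow> dims k d ! (n - 1) = d n"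
  by (cases n) (simp_all add: nth_dims)

lemma kron_rev_others_carrier:
  assumes "l \<in> {1..\<Lambda>}" "n \<in> {1..N + 1}"
  shows "kron_rev (U l) (removeAll n [1..<N + 2]) \<in> carrier_mat
    (prod_list (del_mode n (dims (N + 1) (I l)))) (prod_list (del_mode n (dims (N + 1) (R l))))"
proof -
  have "N + 2 = Suc (N + 1)" by simp
  then show ?thesis
    using assms U[OF assms(1)] del_mode_dims[of n "N + 1"]
    by (simp only: atLeastAtMost_iff) (intro kron_rev_carrier, auto simp del: upt_Suc)
qed

lemma unfold_core_carrier:
  "n \<in> {1..N + 1} \<Longrightarrow> unfold (dims (N + 1) (R l)) n T \<in>
    carrier_mat (R l n) (prod_list (del_mode n (dims (N + 1) (R l))))"
  using unfold_carrier[of "dims (N + 1) (R l)" n T] nth_dims_pred[of n "N + 1" "R l"] by simp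

lemma cofactor_carrier:
  assumes "l \<in> {1..\<Lambda>}" "n \<in> {1..N + 1}"
  shows "cofactor l n \<in> carrier_mat (R l n) (prod_list (del_mode n (dims (N + 1) (I l))))"
  unfolding cofactor_def
  by (intro mult_carrier_mat[OF unfold_core_carrier[OF assms(2)]] transpose_carrier_mat[THEN iffD2] kron_rev_others_carrier assms)

text \<open>\<open>cofactor l n\<close> is built from the core and the factors of the other modes,
  so replacing \<open>U l n\<close> changes only the left factor of the product and the dependence
  is linear.\<close>

lemma unfold_tucker_update:
  assumes l: "l \<in> {1..\<Lambda>}" and n: "n \<in> {1..N + 1}" and X: "X \<in> carrier_mat (I l n) (R l n)"
  shows "unfold (dims (N + 1) (I l)) n (tucker (N + 1) (G l) ((U l)(n := X))) = X * cofactor l n"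
proof -
  have "N + 2 = Suc (N + 1)" by simp
  then have "[1..<N + 2] = [1..<Suc (N + 1)]" by (simp only:)
  moreover have "kron_rev ((U l)(n := X)) (removeAll n [1..<N + 2]) = kron_rev (U l) (removeAll n [1..<N + 2])"
    by (intro kron_rev_cong) (auto simp del: upt_Suc)
  ultimately show ?thesis
    using unfold_tucker[of n "N + 1" "(U l)(n := X)" "I l" "R l" "G l"] n X U[OF l]
    by (simp add: cofactor_def del: upt_Suc add_2_eq_Suc')
qed

text \<open>The mode-\<open>n\<close> unfolding of the derivative of the weight tensor by entry \<open>(i, j)\<close> of \<^term>\<open>U l n\<close>.\<close>

definition unfold_deriv :: "nat \<Rightarrow> nat \<Rightarrow> nat \<Rightarrow> nat \<Rightarrow> real mat" where
  "unfold_deriv l n i j = mat (I l n) (prod_list (del_mode n (dims (N + 1) (I l))))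
     (\<lambda>(a, c). if a = i then cofactor l n $$ (j, c) else 0)"

text \<open>In mode n the weights are linear in the moving factor, which yields
  \<open>unfold_deriv\<close>; the change of mode then supplies the tangent of the last-mode weights
  that \<open>has_real_derivative_loss\<close> expects.\<close>

lemma has_real_derivative_loss_factor:
  assumes l: "l \<in> {1..\<Lambda>}" and n: "n \<in> {1..N + 1}" and ij: "i < I l n" "j < R l n"
  shows "((\<lambda>t. L (layer_out N I \<sigma> Z0 G (U(l := (U l)(n := (U l n |\<^sub>m (i, j) \<mapsto> t)))) b \<Lambda>)) has_real_derivative
     vec_mat (D l * (Z (l - 1))\<^sup>T) \<bullet> vec_mat (unfold (dims (N + 1) (I l)) (N + 1)
       (refold (dims (N + 1) (I l)) n (unfold_deriv l n i j)))) (at (U l n $$ (i, j)))"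
proof -
  let ?ds = "dims (N + 1) (I l)" and ?a = "U l n $$ (i, j)"
  let ?V = "\<lambda>t. U l n |\<^sub>m (i, j) \<mapsto> t"
  let ?W' = "unfold ?ds (N + 1) (refold ?ds n (unfold_deriv l n i j))"
  have n': "1 \<le> n" "n \<le> length ?ds" "1 \<le> N + 1" "N + 1 \<le> length ?ds" using n by auto
  have dn: "?ds ! (n - 1) = I l n" using n by (rule nth_dims_pred)
  have last: "?ds ! (N + 1 - 1) = I l (N + 1)" "del_mode (N + 1) ?ds = dims N (I l)"
    using nth_dims_last[of N "I l"] del_mode_dims_last[of N "I l"] .
  have V: "?V t \<in> carrier_mat (I l n) (R l n)" for t using U[OF l n] by (rule update_mat_carrier)
  have V_a: "?V ?a = U l n" using U[OF l n] ij by (rule update_mat_same)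
  have E: "unfold_deriv l n i j \<in> carrier_mat (?ds ! (n - 1)) (prod_list (del_mode n ?ds))"
    unfolding dn by (simp add: unfold_deriv_def)
  have "((\<lambda>t. L (layer_out N I \<sigma> Z0 G (U(l := (U l)(n := ?V t))) b \<Lambda>)) has_real_derivative
    (\<Sum>p<I l (N + 1). \<Sum>q<prod_list (dims N (I l)). (D l * (Z (l - 1))\<^sup>T) $$ (p, q) * ?W' $$ (p, q))
    + (\<Sum>p<I l (N + 1). (\<Sum>m<M. D l $$ (p, m)) * 0)) (at ?a)"
  proof (rule has_real_derivative_loss[OF l])
    fix p q assume pq: "p < I l (N + 1)" "q < prod_list (dims N (I l))"
    have "((\<lambda>t. unfold ?ds (N + 1) (tucker (N + 1) (G l) ((U l)(n := ?V t))) $$ (p, q)) has_real_derivative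
        ?W' $$ (p, q)) (at ?a)"
    proof (rule has_real_derivative_unfold_change_mode[OF n' E])
      fix k c assume "k < ?ds ! (n - 1)" "c < prod_list (del_mode n ?ds)"
      then show "((\<lambda>t. unfold ?ds n (tucker (N + 1) (G l) ((U l)(n := ?V t))) $$ (k, c)) has_real_derivative
          unfold_deriv l n i j $$ (k, c)) (at ?a)"
        using has_real_derivative_update_mult[OF U[OF l n] cofactor_carrier[OF l n] ij, of k c]
        by (simp add: unfold_tucker_update[OF l n V] unfold_deriv_def dn)
    qed (use pq in \<open>simp_all only: last\<close>)
    then show "((\<lambda>t. weight_mat N I G (U(l := (U l)(n := ?V t))) l $$ (p, q)) has_real_derivative ?W' $$ (p, q)) (at ?a)"
      by (simp add: weight_mat_def)
  qed (use b[OF l] in \<open>auto simp: weight_mat_def V_a\<close>)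
  moreover have "D l * (Z (l - 1))\<^sup>T \<in> carrier_mat (I l (N + 1)) (prod_list (dims N (I l)))"
    using D_carrier[OF l] Z_carrier[OF l] by simp
  moreover have "?W' \<in> carrier_mat (I l (N + 1)) (prod_list (dims N (I l)))"
    using unfold_carrier[of ?ds "N + 1"] last by simp
  ultimately show ?thesis by (simp add: scalar_prod_vec_mat)
qed

lemma mat_grad_factor_index:
  assumes l: "l \<in> {1..\<Lambda>}" and n: "n \<in> {1..N + 1}" and ij: "i < I l n" "j < R l n"
  shows "mat_grad (\<lambda>V. L (layer_out N I \<sigma> Z0 G (U(l := (U l)(n := V))) b \<Lambda>)) (U l n) $$ (i, j) =
     vec_mat (D l * (Z (l - 1))\<^sup>T) \<bullet> vec_mat (unfold (dims (N + 1) (I l)) (N + 1)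
       (refold (dims (N + 1) (I l)) n (unfold_deriv l n i j)))"
  using DERIV_imp_deriv[OF has_real_derivative_loss_factor[OF assms]] ij carrier_matD[OF U[OF l n]]
  by (simp add: mat_grad_def)

lemma mat_partials_exist_factor:
  assumes l: "l \<in> {1..\<Lambda>}" and n: "n \<in> {1..N + 1}"
  shows "mat_partials_exist (\<lambda>V. L (layer_out N I \<sigma> Z0 G (U(l := (U l)(n := V))) b \<Lambda>)) (U l n)"
  using has_real_derivative_loss_factor[OF l n] carrier_matD[OF U[OF l n]]
  unfolding mat_partials_exist_def real_differentiable_def by auto

lemma jacobian_factor:
  assumes l: "l \<in> {1..\<Lambda>}" and n: "n \<in> {1..N + 1}"
  shows "mat_jacobian_exists
      (\<lambda>V. unfold (dims (N + 1) (I l)) n (tucker (N + 1) (G l) ((U l)(n := V)))) (U l n)"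
    and "mat_jacobian
      (\<lambda>V. unfold (dims (N + 1) (I l)) n (tucker (N + 1) (G l) ((U l)(n := V)))) (U l n)
      = kron (cofactor l n)\<^sup>T (1\<^sub>m (I l n))"
  by (rule mat_jacobian_mult_right[OF U[OF l n] cofactor_carrier[OF l n]], rule unfold_tucker_update[OF l n], assumption)+

lemma transpose_cofactor:
  assumes l: "l \<in> {1..\<Lambda>}" and n: "n \<in> {1..N + 1}"
  shows "(cofactor l n)\<^sup>T = kron_rev (U l) (removeAll n [1..<N + 2]) * (unfold (dims (N + 1) (R l)) n (G l))\<^sup>T"
  unfolding cofactor_def
  using transpose_mult[OF unfold_core_carrier[OF n] transpose_carrier_mat[THEN iffD2, OF kron_rev_others_carrier[OF l n]]]
  by simp

text \<open>Compared entry by entry: coordinate q of the gradient pairs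
  \<open>D l * (Z (l - 1))\<^sup>T\<close> with the last-mode derivative in direction q. Vectorized,
  that derivative is \<open>P\<close> applied to column q of the Jacobian.\<close>

lemma vec_mat_grad_factor:
  assumes l: "l \<in> {1..\<Lambda>}" and n: "n \<in> {1..N + 1}"
    and P: "unfold_permutation (dims (N + 1) (I l)) n P"
  shows "vec_mat (mat_grad (\<lambda>V. L (layer_out N I \<sigma> Z0 G (U(l := (U l)(n := V))) b \<Lambda>)) (U l n))
    = (P * kron (cofactor l n)\<^sup>T (1\<^sub>m (I l n)))\<^sup>T *\<^sub>v vec_mat (D l * (Z (l - 1))\<^sup>T)"
    (is "vec_mat ?g = (P * ?J)\<^sup>T *\<^sub>v vec_mat ?B")
proof (rule eq_vecI)
  let ?ds = "dims (N + 1) (I l)"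
  let ?p = "prod_list (del_mode n ?ds)"
  have n': "1 \<le> n" "n \<le> length ?ds" using n by auto
  have dn: "?ds ! (n - 1) = I l n" using n by (rule nth_dims_pred)
  have m: "?p * I l n = prod_list ?ds" using prod_list_del_mode[OF n'] by (simp add: dn mult.commute)
  have Pc: "P \<in> carrier_mat (prod_list ?ds) (prod_list ?ds)"
    using P by (auto simp: unfold_permutation_def permutation_mat_def)
  have J: "?J \<in> carrier_mat (prod_list ?ds) (R l n * I l n)"
    unfolding m[symmetric] by (intro kron_carrier transpose_carrier_mat[THEN iffD2] cofactor_carrier[OF l n]) simp
  have g: "?g \<in> carrier_mat (I l n) (R l n)" using U[OF l n] by (simp add: mat_grad_def)
  have B: "?B \<in> carrier_mat (I l (N + 1)) (prod_list (dims N (I l)))"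
    using D_carrier[OF l] Z_carrier[OF l] by simp
  have B_dim: "vec_mat ?B \<in> carrier_vec (prod_list ?ds)"
  proof (rule carrier_vecI)
    have "?ds ! (N + 1 - 1) * prod_list (del_mode (N + 1) ?ds) = prod_list ?ds"
      by (rule prod_list_del_mode) simp_all
    then show "dim_vec (vec_mat ?B) = prod_list ?ds"
      unfolding del_mode_dims_last nth_dims_last dim_vec_mat[OF B] .
  qed
  show "dim_vec (vec_mat ?g) = dim_vec ((P * ?J)\<^sup>T *\<^sub>v vec_mat ?B)"
    using J by (simp add: dim_vec_mat[OF g] mult.commute)
  fix q assume "q < dim_vec ((P * ?J)\<^sup>T *\<^sub>v vec_mat ?B)"
  then have q: "q < I l n * R l n" using J by (simp add: mult.commute)
  then have lt: "q mod I l n < I l n" "q div I l n < R l n"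
    by (auto simp: less_mult_imp_div_less mult.commute intro!: mod_less_divisor gr0I)
  let ?E = "unfold_deriv l n (q mod I l n) (q div I l n)"
  have E: "?E \<in> carrier_mat (?ds ! (n - 1)) (prod_list (del_mode n ?ds))"
    unfolding dn by (simp add: unfold_deriv_def)
  have colJ: "col ?J q = vec_mat ?E"
    unfolding unfold_deriv_def by (rule col_kron_one[OF cofactor_carrier[OF l n] q])
  have "vec_mat ?g $ q = vec_mat ?B \<bullet> vec_mat (unfold ?ds (N + 1) (refold ?ds n ?E))"
    using vec_mat_index[OF g q] mat_grad_factor_index[OF l n lt] by simp
  \<comment> \<open>The defining property of \<open>P\<close> holds for all tensors, in particular
    for the refolded derivative.\<close>
  also have "vec_mat (unfold ?ds (N + 1) (refold ?ds n ?E)) = P *\<^sub>v vec_mat (unfold ?ds n (refold ?ds n ?E))"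
    using P by (simp add: unfold_permutation_def)
  also have "unfold ?ds n (refold ?ds n ?E) = ?E" by (rule unfold_refold[OF n' E])
  also have "P *\<^sub>v vec_mat ?E = col (P * ?J) q"
    using col_mult2[OF Pc J, of q] q by (simp add: colJ mult.commute)
  also have "vec_mat ?B \<bullet> col (P * ?J) q = col (P * ?J) q \<bullet> vec_mat ?B"
    using Pc by (intro comm_scalar_prod[OF B_dim] carrier_vecI) simp
  also have "\<dots> = ((P * ?J)\<^sup>T *\<^sub>v vec_mat ?B) $ q"
    using J q by (simp add: mult.commute)
  finally show "vec_mat ?g $ q = ((P * ?J)\<^sup>T *\<^sub>v vec_mat ?B) $ q" .
qed

section \<open>The last factor, where no change of mode occurs\<close>

lemma last_mode: "N + 1 \<in> {1..N + 1}"
  by simp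

lemma removeAll_last: "removeAll (N + 1) [1..<N + 2] = [1..<N + 1]"
proof -
  have "[1..<N + 2] = [1..<N + 1] @ [N + 1]" by (simp flip: Suc_eq_plus1)
  then show ?thesis by (simp del: upt_Suc)
qed

lemma kron_rev_last_carrier:
  assumes "l \<in> {1..\<Lambda>}"
  shows "kron_rev (U l) [1..<N + 1] \<in> carrier_mat (prod_list (dims N (I l))) (prod_list (dims N (R l)))"
  using kron_rev_others_carrier[OF assms last_mode]
  unfolding removeAll_last del_mode_dims_last .

text \<open>Folding and unfolding now cancel, and the derivative matrix has the single nonzero row
  i, equal to row j of the cofactor. Pairing with it is a scalar product of two rows, that is, an
  entry of a product with a transpose.\<close>

lemma mat_grad_last_factor:
  assumes l: "l \<in> {1..\<Lambda>}"
  shows "mat_grad (\<lambda>V. L (layer_out N I \<sigma> Z0 G (U(l := (U l)(N + 1 := V))) b \<Lambda>)) (U l (N + 1))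
      = D l * (Z (l - 1))\<^sup>T * kron_rev (U l) [1..<N + 1] * (unfold (dims (N + 1) (R l)) (N + 1) (G l))\<^sup>T"
    (is "?g = ?B * ?K * ?G")
proof -
  let ?n = "N + 1" and ?ds = "dims (N + 1) (I l)" and ?p = "prod_list (dims N (I l))"
  have last: "?ds ! (N + 1 - 1) = I l (N + 1)" "del_mode (N + 1) ?ds = dims N (I l)"
    using nth_dims_last[of N "I l"] del_mode_dims_last[of N "I l"] .
  have n': "1 \<le> ?n" "?n \<le> length ?ds" by auto
  have B: "?B \<in> carrier_mat (I l ?n) ?p" using D_carrier[OF l] Z_carrier[OF l] by simp
  have C: "cofactor l ?n \<in> carrier_mat (R l ?n) ?p"
    using cofactor_carrier[OF l last_mode] unfolding last .
  have "?g = ?B * (cofactor l ?n)\<^sup>T"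
  proof (rule eq_matI)
    show "dim_row ?g = dim_row (?B * (cofactor l ?n)\<^sup>T)" "dim_col ?g = dim_col (?B * (cofactor l ?n)\<^sup>T)"
      using carrier_matD[OF U[OF l last_mode]] carrier_matD[OF C] carrier_matD[OF D_carrier[OF l]]
      by (simp_all add: mat_grad_def)
    fix i j assume "i < dim_row (?B * (cofactor l ?n)\<^sup>T)" "j < dim_col (?B * (cofactor l ?n)\<^sup>T)"
    then have ij: "i < I l ?n" "j < R l ?n" using carrier_matD[OF C] carrier_matD[OF B] by simp_all
    let ?E = "unfold_deriv l ?n i j"
    have E: "?E \<in> carrier_mat (I l ?n) ?p" unfolding unfold_deriv_def last by simp
    have "?g $$ (i, j) = vec_mat ?B \<bullet> vec_mat ?E"
      using mat_grad_factor_index[OF l last_mode ij] unfold_refold[OF n', of ?E] E unfolding last by simp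
    also have "\<dots> = (\<Sum>a<I l ?n. \<Sum>c<?p. ?B $$ (a, c) * (if a = i then cofactor l ?n $$ (j, c) else 0))"
      unfolding scalar_prod_vec_mat[OF B E] unfolding unfold_deriv_def last
      by (intro sum.cong refl) simp
    also have "\<dots> = (\<Sum>a<I l ?n. if a = i then (\<Sum>c<?p. ?B $$ (a, c) * cofactor l ?n $$ (j, c)) else 0)"
      by (intro sum.cong refl) simp
    also have "\<dots> = (?B * (cofactor l ?n)\<^sup>T) $$ (i, j)"
      unfolding index_mult_transpose[OF B C ij] using ij by (simp add: sum.delta del: index_mult_mat(1))
    finally show "?g $$ (i, j) = (?B * (cofactor l ?n)\<^sup>T) $$ (i, j)" .
  qed
  also have "(cofactor l ?n)\<^sup>T = ?K * ?G"
    using transpose_cofactor[OF l last_mode] unfolding removeAll_last .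
  also have "?B * (?K * ?G) = ?B * ?K * ?G"
    using unfold_core_carrier[OF last_mode, of l "G l"] del_mode_dims_last[of N "R l"]
    by (intro assoc_mult_mat[symmetric, OF B kron_rev_last_carrier[OF l]]) (simp add: transpose_carrier_mat)
  finally show ?thesis .
qed

section \<open>Gradient of the core\<close>

lemma has_real_derivative_loss_core:
  assumes l: "l \<in> {1..\<Lambda>}" and ij: "i < R l (N + 1)" "j < prod_list (dims N (R l))"
  defines "V \<equiv> unfold (dims (N + 1) (R l)) (N + 1) (G l)"
  shows "((\<lambda>t. L (layer_out N I \<sigma> Z0 (G(l := refold (dims (N + 1) (R l)) (N + 1) (V |\<^sub>m (i, j) \<mapsto> t))) U b \<Lambda>))
    has_real_derivative ((U l (N + 1))\<^sup>T * D l * (Z (l - 1))\<^sup>T * kron_rev (U l) [1..<N + 1]) $$ (i, j)) (at (V $$ (i, j)))"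
proof -
  let ?n = "N + 1" and ?ds = "dims (N + 1) (R l)" and ?p = "prod_list (dims N (I l))" and ?q = "prod_list (dims N (R l))"
  let ?K = "kron_rev (U l) [1..<N + 1]" and ?B = "D l * (Z (l - 1))\<^sup>T" and ?a = "V $$ (i, j)"
  have last: "?ds ! (N + 1 - 1) = R l (N + 1)" "del_mode (N + 1) ?ds = dims N (R l)"
    using nth_dims_last[of N "R l"] del_mode_dims_last[of N "R l"] .
  have n': "1 \<le> ?n" "?n \<le> length ?ds" "1 \<le> ?n" "?n \<le> ?n" by auto
  have V: "V \<in> carrier_mat (R l ?n) ?q"
    using unfold_core_carrier[OF last_mode, of l "G l"] unfolding V_def last .
  have K: "?K \<in> carrier_mat ?p ?q" by (rule kron_rev_last_carrier[OF l])
  have Un: "U l ?n \<in> carrier_mat (I l ?n) (R l ?n)" by (rule U[OF l last_mode])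
  have B: "?B \<in> carrier_mat (I l ?n) ?p" using D_carrier[OF l] Z_carrier[OF l] by simp
  \<comment> \<open>The unfolded core stands between two fixed matrices, so the derivative of the
    weights by its entry (i, j) is the outer product of column i of \<open>U l ?n\<close> and column
    j of \<open>?K\<close>.\<close>
  have w: "weight_mat N I (G(l := T)) U l = U l ?n * (unfold ?ds ?n T * ?K\<^sup>T)" for T
    using unfold_tucker[of ?n ?n "U l" "I l" "R l" T] U[OF l] removeAll_last
    by (simp add: weight_mat_def del: upt_Suc flip: Suc_eq_plus1)
  have w0: "weight_mat N I G U l = U l ?n * (V * ?K\<^sup>T)"
    using w[of "G l"] by (simp add: V_def weight_mat_def)
  have uV: "unfold ?ds ?n (refold ?ds ?n X) = X" if "X \<in> carrier_mat (R l ?n) ?q" for X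
    using unfold_refold[OF n'(1,2), of X] that unfolding last by simp
  have "((\<lambda>t. L (layer_out N I \<sigma> Z0 (G(l := refold ?ds ?n (V |\<^sub>m (i, j) \<mapsto> t))) U b \<Lambda>)) has_real_derivative
    (\<Sum>a<I l ?n. \<Sum>c<?p. ?B $$ (a, c) * (U l ?n $$ (a, i) * ?K $$ (c, j)))
    + (\<Sum>a<I l ?n. (\<Sum>m<M. D l $$ (a, m)) * 0)) (at ?a)"
  proof (rule has_real_derivative_loss[OF l])
    fix a c assume ac: "a < I l ?n" "c < ?p"
    have "weight_mat N I (G(l := refold ?ds ?n (V |\<^sub>m (i, j) \<mapsto> t))) U l $$ (a, c) =
       (\<Sum>k<R l ?n. U l ?n $$ (a, k) * ((V |\<^sub>m (i, j) \<mapsto> t) * ?K\<^sup>T) $$ (k, c))" for t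
      unfolding w uV[OF update_mat_carrier[OF V]]
      using ac carrier_matD[OF Un] carrier_matD[OF V] carrier_matD[OF K]
      by (subst index_mult_mat(1)) (auto simp: scalar_prod_def atLeast0LessThan)
    moreover have "((\<lambda>t. \<Sum>k<R l ?n. U l ?n $$ (a, k) * ((V |\<^sub>m (i, j) \<mapsto> t) * ?K\<^sup>T) $$ (k, c)) has_real_derivative
       (\<Sum>k<R l ?n. U l ?n $$ (a, k) * (if k = i then ?K\<^sup>T $$ (j, c) else 0))) (at ?a)"
      using ac ij K
      by (intro DERIV_sum DERIV_cmult has_real_derivative_update_mult[OF V, of _ ?p]) auto
    moreover have "(\<Sum>k<R l ?n. U l ?n $$ (a, k) * (if k = i then ?K\<^sup>T $$ (j, c) else 0)) =
       (\<Sum>k<R l ?n. if k = i then U l ?n $$ (a, k) * ?K $$ (c, j) else 0)"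
      using ac ij carrier_matD[OF K] by (intro sum.cong refl) simp
    ultimately show "((\<lambda>t. weight_mat N I (G(l := refold ?ds ?n (V |\<^sub>m (i, j) \<mapsto> t))) U l $$ (a, c)) has_real_derivative
        U l ?n $$ (a, i) * ?K $$ (c, j)) (at ?a)"
      using ij by (simp add: sum.delta)
  next
    \<comment> \<open>Refolding the unfolded core gives back \<open>G l\<close> only at valid
      multi-indices, so the two cores may differ as functions; their weight matrices agree.\<close>
    show "weight_mat N I (G(l := refold ?ds ?n (V |\<^sub>m (i, j) \<mapsto> ?a))) U l = weight_mat N I G U l"
      unfolding w update_mat_same[OF V ij] uV[OF V] w0 ..
  qed (use b[OF l] in \<open>auto simp: weight_mat_def\<close>)
  \<comment> \<open>Pairing \<open>?B\<close> with an outer product of vectors u and k is the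
    bilinear form u^T \<open>?B\<close> k, an entry of the triple product.\<close>
  moreover have "(\<Sum>a<I l ?n. \<Sum>c<?p. ?B $$ (a, c) * (U l ?n $$ (a, i) * ?K $$ (c, j))) =
      ((U l ?n)\<^sup>T * (?B * ?K)) $$ (i, j)"
    by (rule index_transpose_mult_mult[OF Un B K ij, symmetric])
  moreover have "(U l ?n)\<^sup>T * (?B * ?K) = (U l ?n)\<^sup>T * D l * (Z (l - 1))\<^sup>T * ?K"
  proof -
    have Ut: "(U l ?n)\<^sup>T \<in> carrier_mat (R l ?n) (I l ?n)" using Un by simp
    have Zt: "(Z (l - 1))\<^sup>T \<in> carrier_mat M ?p" using Z_carrier[OF l] by simp
    show ?thesis
      unfolding assoc_mult_mat[OF Ut D_carrier[OF l] Zt] by (rule assoc_mult_mat[OF Ut B K, symmetric])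
  qed
  ultimately show ?thesis by simp
qed

lemma core_gradient:
  assumes l: "l \<in> {1..\<Lambda>}"
  defines "V \<equiv> unfold (dims (N + 1) (R l)) (N + 1) (G l)"
    and "f \<equiv> (\<lambda>V. L (layer_out N I \<sigma> Z0 (G(l := refold (dims (N + 1) (R l)) (N + 1) V)) U b \<Lambda>))"
  shows "mat_partials_exist f V"
    and "mat_grad f V = (U l (N + 1))\<^sup>T * D l * (Z (l - 1))\<^sup>T * kron_rev (U l) [1..<N + 1]"
proof -
  have V: "V \<in> carrier_mat (R l (N + 1)) (prod_list (dims N (R l)))"
    using unfold_core_carrier[OF last_mode, of l "G l"] unfolding V_def del_mode_dims_last .
  note deriv = has_real_derivative_loss_core[OF l, folded V_def]
  show "mat_partials_exist f V"
    using deriv carrier_matD[OF V] unfolding mat_partials_exist_def real_differentiable_def f_def by auto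
  show "mat_grad f V = (U l (N + 1))\<^sup>T * D l * (Z (l - 1))\<^sup>T * kron_rev (U l) [1..<N + 1]" (is "_ = ?A")
  proof (rule eq_matI)
    show d: "dim_row (mat_grad f V) = dim_row ?A" "dim_col (mat_grad f V) = dim_col ?A"
      using carrier_matD[OF V] carrier_matD[OF U[OF l last_mode]] carrier_matD[OF kron_rev_last_carrier[OF l]]
      by (simp_all add: mat_grad_def)
    fix i j assume "i < dim_row ?A" "j < dim_col ?A"
    then have ij: "i < R l (N + 1)" "j < prod_list (dims N (R l))"
      using d carrier_matD[OF V] by (simp_all add: mat_grad_def)
    then show "mat_grad f V $$ (i, j) = ?A $$ (i, j)"
      using DERIV_imp_deriv[OF deriv[OF ij]] carrier_matD[OF V]
      by (simp add: mat_grad_def f_def del: index_mult_mat(1))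
  qed
qed

section \<open>Gradient of the bias\<close>

lemma has_real_derivative_loss_bias:
  assumes l: "l \<in> {1..\<Lambda>}" and i: "i < I l (N + 1)"
  shows "((\<lambda>t. L (layer_out N I \<sigma> Z0 G U (b(l := (b l |\<^sub>v i \<mapsto> t))) \<Lambda>)) has_real_derivative
    (\<Sum>m<M. D l $$ (i, m))) (at (b l $ i))"
proof -
  have bl: "b l \<in> carrier_vec (I l (N + 1))" by (rule b[OF l])
  have "((\<lambda>t. L (layer_out N I \<sigma> Z0 G U (b(l := (b l |\<^sub>v i \<mapsto> t))) \<Lambda>)) has_real_derivative
    (\<Sum>p<I l (N + 1). \<Sum>q<prod_list (dims N (I l)). (D l * (Z (l - 1))\<^sup>T) $$ (p, q) * 0)
    + (\<Sum>p<I l (N + 1). (\<Sum>m<M. D l $$ (p, m)) * (if p = i then 1 else 0))) (at (b l $ i))"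
  proof (rule has_real_derivative_loss[OF l])
    fix p assume p: "p < I l (N + 1)"
    have "(\<lambda>t. (b(l := (b l |\<^sub>v i \<mapsto> t))) l $ p) = (if p = i then (\<lambda>t. t) else (\<lambda>t. b l $ p))"
      using p bl by (auto simp: update_vec_def)
    then show "((\<lambda>t. (b(l := (b l |\<^sub>v i \<mapsto> t))) l $ p) has_real_derivative (if p = i then 1 else 0)) (at (b l $ i))"
      by simp
  next
    have "(b l |\<^sub>v i \<mapsto> b l $ i) = b l" by (intro eq_vecI) (auto simp: update_vec_def)
    then show "(b(l := (b l |\<^sub>v i \<mapsto> b l $ i))) l = b l" by simp
    show "(b(l := (b l |\<^sub>v i \<mapsto> t))) l \<in> carrier_vec (I l (N + 1))" for t
      using bl unfolding carrier_vec_def by simp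
  qed simp_all
  moreover have "(\<Sum>p<I l (N + 1). (\<Sum>m<M. D l $$ (p, m)) * (if p = i then 1 else 0)) =
      (\<Sum>p<I l (N + 1). if p = i then (\<Sum>m<M. D l $$ (p, m)) else 0)"
    by (intro sum.cong refl) simp
  ultimately show ?thesis using i by simp
qed

text \<open>Row i of the Kronecker product selects from vec(D) the positions congruent to i modulo
  the number of rows, one for each sample. Its product with vec(D) is therefore the sum of row i of
  \<open>D l\<close>, the derivative along the i-th bias curve.\<close>

lemma bias_gradient:
  assumes l: "l \<in> {1..\<Lambda>}"
  defines "f \<equiv> (\<lambda>v. L (layer_out N I \<sigma> Z0 G U (b(l := v)) \<Lambda>))"
  shows "vec_partials_exist f (b l)"
    and "vec_grad f (b l) = kron (ones_row M) (1\<^sub>m (I l (N + 1))) *\<^sub>v vec_mat (D l)"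
proof -
  let ?n = "I l (N + 1)"
  have bl: "dim_vec (b l) = ?n" using b[OF l] by simp
  note deriv = has_real_derivative_loss_bias[OF l]
  have Dl: "D l \<in> carrier_mat ?n M" by (rule D_carrier[OF l])
  show "vec_partials_exist f (b l)"
    using deriv unfolding vec_partials_exist_def real_differentiable_def f_def bl by auto
  show "vec_grad f (b l) = kron (ones_row M) (1\<^sub>m ?n) *\<^sub>v vec_mat (D l)" (is "_ = ?v")
  proof (rule eq_vecI)
    show d: "dim_vec (vec_grad f (b l)) = dim_vec ?v" by (simp add: vec_grad_def bl kron_def ones_row_def)
    fix i assume "i < dim_vec ?v"
    then have i: "i < ?n" by (simp add: kron_def ones_row_def)
    have "?v $ i = (\<Sum>k<?n * M. (if k mod ?n = i then 1 else 0) * D l $$ (k mod ?n, k div ?n))"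
    proof -
      have "?v $ i = (\<Sum>k<?n * M. kron (ones_row M) (1\<^sub>m ?n) $$ (i, k) * vec_mat (D l) $ k)"
        using i dim_vec_mat[OF Dl]
        by (simp add: scalar_prod_def atLeast0LessThan kron_def ones_row_def mult.commute)
      also have "\<dots> = (\<Sum>k<?n * M. (if k mod ?n = i then 1 else 0) * D l $$ (k mod ?n, k div ?n))"
      proof (intro sum.cong refl)
        fix k assume "k \<in> {..<?n * M}"
        then have k: "k < ?n * M" by simp
        have "k mod ?n < ?n" "k div ?n < M"
          using k i by (auto simp: less_mult_imp_div_less mult.commute)
        then show "kron (ones_row M) (1\<^sub>m ?n) $$ (i, k) * vec_mat (D l) $ k =
           (if k mod ?n = i then 1 else 0) * D l $$ (k mod ?n, k div ?n)"
          using i k by (auto simp: vec_mat_index[OF Dl k] kron_def ones_row_def mult.commute)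
      qed
      finally show ?thesis .
    qed
    also have "\<dots> = (\<Sum>p<?n. \<Sum>m<M. (if p = i then 1 else 0) * D l $$ (p, m))"
      by (rule sum_mod_div[of "\<lambda>p m. (if p = i then 1 else 0) * D l $$ (p, m)"])
    also have "\<dots> = (\<Sum>p<?n. if p = i then (\<Sum>m<M. D l $$ (p, m)) else 0)"
      by (intro sum.cong refl) simp
    also have "\<dots> = (\<Sum>m<M. D l $$ (i, m))" using i by simp
    finally show "vec_grad f (b l) $ i = ?v $ i"
      using DERIV_imp_deriv[OF deriv[OF i]] i by (simp add: vec_grad_def f_def bl del: index_mult_mat_vec)
  qed
qed

end

section \<open>All parameter gradients of a layer\<close>

theorem mainTheorem2:
  fixes N M \<Lambda> :: nat
    and I R :: "nat \<Rightarrow> nat \<Rightarrow> nat"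
    and G W :: "nat \<Rightarrow> tensor"
    and U :: "nat \<Rightarrow> nat \<Rightarrow> real mat"
    and b :: "nat \<Rightarrow> real vec"
    and X :: "nat \<Rightarrow> tensor"
    and \<sigma> :: "real \<Rightarrow> real"
    and L :: "real mat \<Rightarrow> real"
    and Z F D :: "nat \<Rightarrow> real mat"
    and Z0 :: "real mat"
    and loss :: "(nat \<Rightarrow> tensor) \<Rightarrow> (nat \<Rightarrow> nat \<Rightarrow> real mat) \<Rightarrow> (nat \<Rightarrow> real vec) \<Rightarrow> real"
  assumes "N \<ge> 1" and "M \<ge> 1" and "\<Lambda> \<ge> 1"
    and "\<And>l n. l \<in> {1..\<Lambda>} \<Longrightarrow> n \<in> {1..N + 1} \<Longrightarrow> I l n > 0"
    and "\<And>l n. l \<in> {1..\<Lambda>} \<Longrightarrow> n \<in> {1..N + 1} \<Longrightarrow> R l n > 0"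
    and "\<And>l. l \<in> {2..\<Lambda>} \<Longrightarrow> (\<Prod>n = 1..N. I l n) = I (l - 1) (N + 1)"
    and "\<And>l n. l \<in> {1..\<Lambda>} \<Longrightarrow> n \<in> {1..N + 1} \<Longrightarrow> U l n \<in> carrier_mat (I l n) (R l n)"
    and "\<And>l. l \<in> {1..\<Lambda>} \<Longrightarrow> b l \<in> carrier_vec (I l (N + 1))"
    and W: "\<And>l. W l = tucker (N + 1) (G l) (U l)"
    and Z0: "Z0 = mat_of_cols (prod_list (dims N (I 1)))
                    (map (\<lambda>m. vec_tensor (dims N (I 1)) (X m)) [0..<M])"
    and "\<And>x. \<sigma> differentiable (at x)"
    and Z: "Z = layer_out N I \<sigma> Z0 G U b"
    and F: "\<And>l. l \<in> {1..\<Lambda>} \<Longrightarrow> F l = pre_activation (unfold (dims (N + 1) (I l)) (N + 1) (W l)) (b l) (Z (l - 1))"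
    and "\<And>Y. Y \<in> carrier_mat (I \<Lambda> (N + 1)) M \<Longrightarrow> mat_differentiable L Y"
    and loss: "\<And>G U b. loss G U b = L (layer_out N I \<sigma> Z0 G U b \<Lambda>)"
    and D_last: "D \<Lambda> = mat_grad (\<lambda>Y. L (map_mat \<sigma> Y)) (F \<Lambda>)"
    and D_step: "\<And>l. l \<in> {1..<\<Lambda>} \<Longrightarrow>
           D l = hadamard ((unfold (dims (N + 1) (I (l + 1))) (N + 1) (W (l + 1)))\<^sup>T * D (l + 1))
                          (map_mat (deriv \<sigma>) (F l))"
  shows "\<forall>l \<in> {1..\<Lambda>}.
    (\<forall>n \<in> {1..N + 1}.
       mat_partials_exist (\<lambda>V. loss G (U(l := (U l)(n := V))) b) (U l n) \<and>
       mat_jacobian_exists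
         (\<lambda>V. unfold (dims (N + 1) (I l)) n (tucker (N + 1) (G l) ((U l)(n := V)))) (U l n) \<and>
       mat_jacobian
         (\<lambda>V. unfold (dims (N + 1) (I l)) n (tucker (N + 1) (G l) ((U l)(n := V)))) (U l n)
         = kron (kron_rev (U l) (removeAll n [1..<N + 2]) * (unfold (dims (N + 1) (R l)) n (G l))\<^sup>T)
                (1\<^sub>m (I l n)) \<and>
       (\<exists>!P. unfold_permutation (dims (N + 1) (I l)) n P) \<and>
       (\<forall>P. unfold_permutation (dims (N + 1) (I l)) n P \<longrightarrow>
          vec_mat (mat_grad (\<lambda>V. loss G (U(l := (U l)(n := V))) b) (U l n))
          = (P * mat_jacobian
                   (\<lambda>V. unfold (dims (N + 1) (I l)) n (tucker (N + 1) (G l) ((U l)(n := V)))) (U l n))\<^sup>T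
            *\<^sub>v vec_mat (D l * (Z (l - 1))\<^sup>T))) \<and>
    mat_grad (\<lambda>V. loss G (U(l := (U l)(N + 1 := V))) b) (U l (N + 1))
      = D l * (Z (l - 1))\<^sup>T * kron_rev (U l) [1..<N + 1]
        * (unfold (dims (N + 1) (R l)) (N + 1) (G l))\<^sup>T \<and>
    mat_partials_exist (\<lambda>V. loss (G(l := refold (dims (N + 1) (R l)) (N + 1) V)) U b)
      (unfold (dims (N + 1) (R l)) (N + 1) (G l)) \<and>
    mat_grad (\<lambda>V. loss (G(l := refold (dims (N + 1) (R l)) (N + 1) V)) U b)
      (unfold (dims (N + 1) (R l)) (N + 1) (G l))
      = (U l (N + 1))\<^sup>T * D l * (Z (l - 1))\<^sup>T * kron_rev (U l) [1..<N + 1] \<and>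
    vec_partials_exist (\<lambda>v. loss G U (b(l := v))) (b l) \<and>
    vec_grad (\<lambda>v. loss G U (b(l := v))) (b l)
      = kron (ones_row M) (1\<^sub>m (I l (N + 1))) *\<^sub>v vec_mat (D l)"
proof -
  have W': "unfold (dims (N + 1) (I l)) (N + 1) (W l) = weight_mat N I G U l" for l
    by (simp add: weight_mat_def W)
  interpret tucker_network N M \<Lambda> I R G U b \<sigma> L Z F D Z0
  proof unfold_locales
    show "Z0 \<in> carrier_mat (prod_list (dims N (I 1))) M" unfolding Z0 by (intro carrier_matI) simp_all
  qed (use assms W' prod_list_dims in auto)
  show ?thesis
    unfolding loss
  proof (intro ballI conjI allI impI, goal_cases)
    case (1 l n)
    then show ?case by (rule mat_partials_exist_factor)
  next
    case (2 l n)
    then show ?case by (rule jacobian_factor)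
  next
    case (3 l n)
    show ?case unfolding jacobian_factor(2)[OF 3] transpose_cofactor[OF 3] ..
  next
    case (4 l n)
    then show ?case by (intro unfold_permutation_ex1) simp_all
  next
    case (5 l n P)
    show ?case unfolding jacobian_factor(2)[OF 5(1,2)] by (rule vec_mat_grad_factor[OF 5])
  next
    case (6 l)
    then show ?case by (rule mat_grad_last_factor)
  next
    case (7 l)
    then show ?case by (rule core_gradient)
  next
    case (8 l)
    then show ?case by (rule core_gradient)
  next
    case (9 l)
    then show ?case by (rule bias_gradient)
  next
    case (10 l)
    then show ?case by (rule bias_gradient)
  qed
qed

end
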